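(* The space $\mathcal{M}^2_\omega(\mathcal{R})$ is a Hilbert space with reproducing kernel and with the unique inner product such that $$\|f\|_{\mathcal{M}^2_\omega(\mathcal{R})}^2=\sum_{n=0}^{+\infty}\frac{2^n}{n!}\int_{-\infty}^{+\infty}\big|f\big(\tfrac n2+iy\big)\big|^2\,dy<\infty .$$
   Context: $\mathcal{R}=\{z\in\mathbf{C}:\Re z>0\}$ and $\overline{\mathcal{R}}$ is its closure. For $0<b<\infty$, $S_b=\{x+iy:0<x<b\}$ and $H^2(S_b)$ is the space of holomorphic $f$ on $S_b$ with $\sup_{0<x<b}\int_{-\infty}^{+\infty}|f(x+iy)|^2\,dy<\infty$; for such $f$ the functions $f(x+i\cdot)$ have a limit in $L^2(\mathbf{R})$ as $x\to0^+$, denoted $f(0+i\cdot)$ (boundary values on the imaginary axis). Let $\omega=\sum_{n=0}^{+\infty}\frac{2^n}{n!}\,\delta_{n/2}(x)\otimes dy$ be the Borel measure on $\overline{\mathcal{R}}$, so that $\|f\|^2_{L^2(\overline{\mathcal{R}},d\omega)}=\sum_{n\ge0}\frac{2^n}{n!}\int_{-\infty}^{+\infty}|f(\frac n2+iy)|^2\,dy$. The space $\mathcal{M}^2_\omega(\mathcal{R})$ consists of the holomorphic functions $f$ on $\mathcal{R}$ such that $f\in H^2(S_b)$ for every $0<b<\infty$ and $f\in L^2(\overline{\mathcal{R}},d\omega)$, where on the imaginary axis (the $n=0$ term) $f$ is understood as its boundary values. *)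

theory Defs
  imports "HOL-Complex_Analysis.Complex_Analysis" "HOL-Library.Function_Algebras"
begin

definition complex_function_subspace :: "('a \<Rightarrow> complex) set \<Rightarrow> bool" where
  "complex_function_subspace V \<longleftrightarrow>
     module.subspace (\<lambda>(c::complex) (f::'a \<Rightarrow> complex) x. c * f x) V"

text \<open>Inner products are linear in the first argument. Only their values on
  \<open>V \<times> V\<close> are meaningful.\<close>

definition inner_product_on ::
    "('a \<Rightarrow> complex) set \<Rightarrow> (('a \<Rightarrow> complex) \<Rightarrow> ('a \<Rightarrow> complex) \<Rightarrow> complex) \<Rightarrow> bool" where
  "inner_product_on V ip \<longleftrightarrow>
     (\<forall>f\<in>V. \<forall>g\<in>V. \<forall>h\<in>V. ip (f + g) h = ip f h + ip g h) \<and>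
     (\<forall>c. \<forall>f\<in>V. \<forall>g\<in>V. ip (\<lambda>x. c * f x) g = c * ip f g) \<and>
     (\<forall>f\<in>V. \<forall>g\<in>V. ip g f = cnj (ip f g)) \<and>
     (\<forall>f\<in>V. f \<noteq> 0 \<longrightarrow> Re (ip f f) > 0)"

definition ip_norm ::
    "(('a \<Rightarrow> complex) \<Rightarrow> ('a \<Rightarrow> complex) \<Rightarrow> complex) \<Rightarrow> ('a \<Rightarrow> complex) \<Rightarrow> real" where
  "ip_norm ip f = sqrt (Re (ip f f))"

definition hilbert_space_on ::
    "('a \<Rightarrow> complex) set \<Rightarrow> (('a \<Rightarrow> complex) \<Rightarrow> ('a \<Rightarrow> complex) \<Rightarrow> complex) \<Rightarrow> bool" where
  "hilbert_space_on V ip \<longleftrightarrow>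
     complex_function_subspace V \<and> inner_product_on V ip \<and>
     Metric_space.mcomplete V (\<lambda>f g. ip_norm ip (f - g))"

text \<open>\<open>K w\<close> is the kernel function \<open>K(\<cdot>, w)\<close>.\<close>

definition reproducing_kernel_on ::
    "'a set \<Rightarrow> ('a \<Rightarrow> complex) set \<Rightarrow> (('a \<Rightarrow> complex) \<Rightarrow> ('a \<Rightarrow> complex) \<Rightarrow> complex) \<Rightarrow>
     ('a \<Rightarrow> 'a \<Rightarrow> complex) \<Rightarrow> bool" where
  "reproducing_kernel_on X V ip K \<longleftrightarrow>
     (\<forall>w\<in>X. K w \<in> V \<and> (\<forall>f\<in>V. f w = ip f (K w)))"

definition square_integrable :: "'a measure \<Rightarrow> ('a \<Rightarrow> complex) set" where
  "square_integrable M =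
     {f. f \<in> borel_measurable M \<and> (\<integral>\<^sup>+x. ennreal ((cmod (f x))\<^sup>2) \<partial>M) < \<infinity>}"

definition right_half_plane :: "complex set" where
  "right_half_plane = {z. Re z > 0}"

definition strip :: "real \<Rightarrow> complex set" where
  "strip b = {z. 0 < Re z \<and> Re z < b}"

definition H2_strip :: "real \<Rightarrow> (complex \<Rightarrow> complex) set" where
  "H2_strip b = {f. f holomorphic_on strip b \<and>
     (SUP x\<in>{0<..<b}. \<integral>\<^sup>+y. ennreal ((cmod (f (Complex x y)))\<^sup>2) \<partial>lborel) < \<infinity>}"

definition is_boundary_value :: "(complex \<Rightarrow> complex) \<Rightarrow> (real \<Rightarrow> complex) \<Rightarrow> bool" where
  "is_boundary_value f g \<longleftrightarrow>
     g \<in> square_integrable lborel \<and>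
     ((\<lambda>x. \<integral>\<^sup>+y. ennreal ((cmod (f (Complex x y) - g y))\<^sup>2) \<partial>lborel) \<longlongrightarrow> 0) (at_right 0)"

text \<open>The \<open>L\<^sup>2\<close> limit is only determined up to null sets; some representative is chosen.\<close>

definition boundary_value :: "(complex \<Rightarrow> complex) \<Rightarrow> real \<Rightarrow> complex" where
  "boundary_value f = (SOME g. is_boundary_value f g)"

definition with_boundary :: "(complex \<Rightarrow> complex) \<Rightarrow> complex \<Rightarrow> complex" where
  "with_boundary f z = (if Re z = 0 then boundary_value f (Im z) else f z)"

definition nu :: "real measure" where
  "nu = distr (point_measure UNIV (\<lambda>n::nat. ennreal (2 ^ n / fact n))) borel (\<lambda>n. real n / 2)"

definition omega :: "complex measure" where
  "omega = restrict_space (distr (nu \<Otimes>\<^sub>M lborel) borel (\<lambda>(x, y). Complex x y))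
             (closure right_half_plane)"

lemma nn_integral_nu: "g \<in> borel_measurable borel \<Longrightarrow> (\<integral>\<^sup>+x. g x \<partial>nu) = (\<Sum>n. ennreal (2^n/fact n) * g (real n/2))"
  unfolding nu_def point_measure_def
  by (subst nn_integral_distr) (auto simp: nn_integral_density nn_integral_count_space_nat)

lemma nn_integral_omega:
  assumes [measurable]: "g \<in> borel_measurable borel"
  shows "(\<integral>\<^sup>+z. g z \<partial>omega) = (\<Sum>n. ennreal (2^n/fact n) * (\<integral>\<^sup>+y. g (Complex (real n/2) y) \<partial>lborel))"
proof -
  have c: "closure right_half_plane = {z. Re z \<ge> 0}"
    unfolding right_half_plane_def using closure_halfspace_gt[of "1::complex" 0] by (simp add: inner_complex_def)
  have [measurable_cong]: "sets nu = sets borel" by (simp add: nu_def)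
  have [measurable]: "(\<lambda>(x,y). Complex x y) \<in> borel \<Otimes>\<^sub>M borel \<rightarrow>\<^sub>M borel"
    unfolding Complex_eq by measurable
  have m: "{z::complex. 0 \<le> Re z} \<in> sets borel" by measurable
  have [measurable]: "Complex a \<in> borel \<rightarrow>\<^sub>M borel" for a
    unfolding Complex_eq by measurable
  have "(\<integral>\<^sup>+z. g z \<partial>omega) = (\<integral>\<^sup>+z. g z * indicator {z. Re z \<ge> 0} z \<partial>distr (nu \<Otimes>\<^sub>M lborel) borel (\<lambda>(x, y). Complex x y))"
    unfolding omega_def c using m by (subst nn_integral_restrict_space) auto
  also have "\<dots> = (\<integral>\<^sup>+p. g (Complex (fst p) (snd p)) * indicator {z. Re z \<ge> 0} (Complex (fst p) (snd p)) \<partial>(nu \<Otimes>\<^sub>M lborel))"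
    by (subst nn_integral_distr) (use m in \<open>auto simp: case_prod_unfold\<close>)
  also have "\<dots> = (\<integral>\<^sup>+x. \<integral>\<^sup>+y. g (Complex x y) * indicator {z. Re z \<ge> 0} (Complex x y) \<partial>lborel \<partial>nu)"
    using m by (subst lborel.nn_integral_fst[symmetric]) (auto simp: split_beta')
  also have "\<dots> = (\<Sum>n. ennreal (2^n/fact n) * (\<integral>\<^sup>+y. g (Complex (real n/2) y) * indicator {z. Re z \<ge> 0} (Complex (real n/2) y) \<partial>lborel))"
    using m by (subst nn_integral_nu) auto
  finally show ?thesis by (simp add: indicator_def)
qed

text \<open>Functions on the half-plane are represented by total functions vanishing
  outside it, so that equality in the space is equality of functions.\<close>

definition M2_omega :: "(complex \<Rightarrow> complex) set" where
  "M2_omega = {f. f holomorphic_on right_half_plane \<and>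
     (\<forall>z. z \<notin> right_half_plane \<longrightarrow> f z = 0) \<and>
     (\<forall>b>0. f \<in> H2_strip b) \<and>
     with_boundary f \<in> square_integrable omega}"

end

theory Submission imports Defs begin

text \<open>
  Write \<open>F(x)\<close> for the integral of \<open>|f|\<^sup>2\<close> over the vertical line of abscissa \<open>x\<close>. Everything
  rests on one inequality for \<open>f\<close> in the Hardy space of a strip (\<open>line_energy_midpoint\<close>): the
  squared \<open>L\<^sup>2\<close> distance between the traces of \<open>f\<close> on the lines \<open>x1\<close> and \<open>x2\<close> is at most
  \<open>F(x1) + F(x2) - 2 F((x1 + x2)/2)\<close>. Indeed, the inner product of the two traces is the integral
  of the holomorphic function \<open>f(z) \<cdot> cnj (f (x1 + x2 - cnj z))\<close> over the line \<open>x1\<close>, and moving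
  the line of integration to the midpoint turns that integrand into \<open>|f|\<^sup>2\<close>.

  The inequality has two consequences. It makes \<open>F\<close> midpoint convex; as \<open>F\<close> is bounded, \<open>F\<close> is
  at most the larger of its values at the ends of any interval, and therefore it has a limit at
  \<open>0\<close>. Near \<open>0\<close> the right-hand side is then small, so the traces form a Cauchy family in \<open>L\<^sup>2\<close>
  and boundary values exist (\<open>H2_strip_boundary_value_exists\<close>). And \<open>F\<close> on
  a strip is controlled by the boundary values and by a single line further to the right
  (\<open>line_energy_le_boundary\<close>). Since \<open>\<omega>\<close> charges the imaginary axis and
  arbitrarily distant lines, the norm of \<open>L\<^sup>2(\<omega>)\<close> dominates \<open>F\<close> on every strip
  (\<open>line_energy_le_omega\<close>), and then, by a Cauchy estimate (\<open>H2_strip_point_bound\<close>), the values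
  of \<open>f\<close> locally uniformly.

  So a sequence that is Cauchy in norm converges locally uniformly to a holomorphic function, and
  Fatou's lemma carries the bounds on lines to the limit, which gives completeness
  (\<open>M2_square_cauchy_converges\<close>). The same pointwise bound says that evaluations are bounded
  functionals, and the Riesz representation theorem turns them into the reproducing kernel. The
  inner product is determined by its norm through polarization.
\<close>

section \<open>Square-integrable functions\<close>

definition L2sq :: "'a measure \<Rightarrow> ('a \<Rightarrow> complex) \<Rightarrow> ennreal" where
  "L2sq M u = (\<integral>\<^sup>+x. ennreal ((cmod (u x))\<^sup>2) \<partial>M)"

lemma cmod_add_sq_le: "(cmod (a + b))\<^sup>2 \<le> 2 * (cmod a)\<^sup>2 + 2 * (cmod b)\<^sup>2"
proof -
  have "(cmod (a + b))\<^sup>2 \<le> (cmod a + cmod b)\<^sup>2"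
    by (intro power_mono norm_triangle_ineq) auto
  also have "\<dots> \<le> 2 * (cmod a)\<^sup>2 + 2 * (cmod b)\<^sup>2"
    using sum_squares_bound[of "cmod a" "cmod b"] by (simp add: power2_sum)
  finally show ?thesis .
qed

lemma L2sq_cong_AE: "AE x in M. u x = v x \<Longrightarrow> L2sq M u = L2sq M v"
  unfolding L2sq_def by (rule nn_integral_cong_AE) auto

lemma L2sq_minus_commute: "L2sq M (\<lambda>x. u x - v x) = L2sq M (\<lambda>x. v x - u x)"
  unfolding L2sq_def by (simp add: norm_minus_commute)

text \<open>A substitute for the triangle inequality of the norm that stays with squares, which is what integrals compute.\<close>

lemma L2sq_add_le:
  assumes [measurable]: "u \<in> borel_measurable M" "v \<in> borel_measurable M"
  shows "L2sq M (\<lambda>x. u x + v x) \<le> 2 * L2sq M u + 2 * L2sq M v"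
proof -
  have "L2sq M (\<lambda>x. u x + v x) \<le> (\<integral>\<^sup>+x. 2 * ennreal ((cmod (u x))\<^sup>2) + 2 * ennreal ((cmod (v x))\<^sup>2) \<partial>M)"
    unfolding L2sq_def
  proof (rule nn_integral_mono)
    fix x
    have "ennreal ((cmod (u x + v x))\<^sup>2) \<le> ennreal (2 * (cmod (u x))\<^sup>2 + 2 * (cmod (v x))\<^sup>2)"
      by (rule ennreal_leI[OF cmod_add_sq_le])
    also have "\<dots> = 2 * ennreal ((cmod (u x))\<^sup>2) + 2 * ennreal ((cmod (v x))\<^sup>2)"
      by (simp add: ennreal_plus ennreal_mult)
    finally show "ennreal ((cmod (u x + v x))\<^sup>2) \<le> 2 * ennreal ((cmod (u x))\<^sup>2) + 2 * ennreal ((cmod (v x))\<^sup>2)" .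
  qed
  also have "\<dots> = 2 * L2sq M u + 2 * L2sq M v"
    unfolding L2sq_def by (simp add: nn_integral_add nn_integral_cmult)
  finally show ?thesis .
qed

lemma L2sq_diff_le:
  assumes [measurable]: "u \<in> borel_measurable M" "v \<in> borel_measurable M" "w \<in> borel_measurable M"
  shows "L2sq M (\<lambda>x. u x - w x) \<le> 2 * L2sq M (\<lambda>x. u x - v x) + 2 * L2sq M (\<lambda>x. v x - w x)"
  using L2sq_add_le[of "\<lambda>x. u x - v x" M "\<lambda>x. v x - w x"] by simp

lemma L2sq_le_diff:
  assumes [measurable]: "u \<in> borel_measurable M" "v \<in> borel_measurable M"
  shows "L2sq M u \<le> 2 * L2sq M (\<lambda>x. u x - v x) + 2 * L2sq M v"
  using L2sq_add_le[of "\<lambda>x. u x - v x" M v] by simp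

lemma L2sq_cmult:
  assumes [measurable]: "u \<in> borel_measurable M"
  shows "L2sq M (\<lambda>x. c * u x) = ennreal ((cmod c)\<^sup>2) * L2sq M u"
  unfolding L2sq_def by (simp add: norm_mult power_mult_distrib ennreal_mult nn_integral_cmult)

lemma L2sq_eq_0_iff:
  assumes [measurable]: "u \<in> borel_measurable M"
  shows "L2sq M u = 0 \<longleftrightarrow> (AE x in M. u x = 0)"
  unfolding L2sq_def by (subst nn_integral_0_iff_AE) auto

text \<open>This is how a bound that holds along a sequence passes to a pointwise limit.\<close>

lemma L2sq_Fatou:
  assumes [measurable]: "\<And>n. u n \<in> borel_measurable M" "v \<in> borel_measurable M"
  assumes lim: "AE x in M. (\<lambda>n. u n x) \<longlonglongrightarrow> w x"
    and bound: "eventually (\<lambda>n. L2sq M (\<lambda>x. u n x - v x) \<le> C) sequentially"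
  shows "L2sq M (\<lambda>x. w x - v x) \<le> C"
proof -
  have "L2sq M (\<lambda>x. w x - v x) = (\<integral>\<^sup>+x. liminf (\<lambda>n. ennreal ((cmod (u n x - v x))\<^sup>2)) \<partial>M)"
    unfolding L2sq_def
  proof (rule nn_integral_cong_AE, use lim in eventually_elim)
    case (elim x)
    have "(\<lambda>n. ennreal ((cmod (u n x - v x))\<^sup>2)) \<longlonglongrightarrow> ennreal ((cmod (w x - v x))\<^sup>2)"
      by (intro tendsto_intros tendsto_ennrealI elim)
    then show ?case by (intro lim_imp_Liminf[symmetric]) auto
  qed
  also have "\<dots> \<le> liminf (\<lambda>n. L2sq M (\<lambda>x. u n x - v x))"
    unfolding L2sq_def by (rule nn_integral_liminf) auto
  also have "\<dots> \<le> C"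
    using bound by (intro Liminf_le) (auto simp: trivial_limit_sequentially)
  finally show ?thesis .
qed

text \<open>The geometric mean of \<open>2^(-k)\<close> and \<open>2^k |d|\<^sup>2\<close> is \<open>|d|\<close>, and both of these are summable.\<close>

lemma summable_norm_of_weighted_squares:
  fixes d :: "nat \<Rightarrow> complex"
  assumes "(\<Sum>k. ennreal (2 ^ k * (cmod (d k))\<^sup>2)) < \<infinity>"
  shows "summable (\<lambda>k. cmod (d k))"
proof -
  have s: "summable (\<lambda>k. 2 ^ k * (cmod (d k))\<^sup>2)"
    using assms by (intro summable_suminf_not_top) auto
  have "summable (\<lambda>k. (1/2) ^ k + 2 ^ k * (cmod (d k))\<^sup>2)"
    by (intro summable_add s summable_geometric) auto
  then show ?thesis
  proof (rule summable_comparison_test')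
    fix k :: nat
    have "0 \<le> (1/2) ^ k * (1 - 2 ^ k * cmod (d k))\<^sup>2" by simp
    also have "\<dots> = (1/2) ^ k - 2 * (((1/2) ^ k * 2 ^ k) * cmod (d k)) + ((1/2) ^ k * 2 ^ k) * (2 ^ k * (cmod (d k))\<^sup>2)"
      by (simp only: power2_eq_square) (simp add: algebra_simps)
    also have "(1/2) ^ k * 2 ^ k = (1::real)" by (simp add: power_divide)
    finally have "2 * cmod (d k) \<le> (1/2)^k + 2 ^ k * (cmod (d k))\<^sup>2" by simp
    then show "norm (cmod (d k)) \<le> (1/2) ^ k + 2 ^ k * (cmod (d k))\<^sup>2"
      using norm_ge_zero[of "d k"] by (simp del: norm_ge_zero)
  qed
qed

text \<open>The Riesz-Fischer theorem. Along a subsequence whose steps have squared norm at most \<open>4^(-k)\<close>, the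
  sum of \<open>2^k\<close> times the squared steps is integrable, hence finite almost everywhere, and the
  previous lemma makes the steps absolutely summable there. Fatou's lemma then gives convergence in
  \<open>L\<^sup>2\<close>.\<close>

theorem L2sq_complete:
  fixes u :: "nat \<Rightarrow> 'a \<Rightarrow> complex"
  assumes [measurable]: "\<And>n. u n \<in> borel_measurable M"
  assumes cauchy: "\<And>e::real. e > 0 \<Longrightarrow> \<exists>n0. \<forall>m\<ge>n0. \<forall>n\<ge>n0. L2sq M (\<lambda>x. u m x - u n x) \<le> ennreal e"
  obtains g where "g \<in> borel_measurable M" "(\<lambda>n. L2sq M (\<lambda>x. u n x - g x)) \<longlonglongrightarrow> 0"
proof -
  have "\<exists>r. \<forall>k. (\<forall>m\<ge>r k. \<forall>n\<ge>r k. L2sq M (\<lambda>x. u m x - u n x) \<le> ennreal ((1/4) ^ k)) \<and> k \<le> r k \<and> r k \<le> r (Suc k)"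
  proof -
    have "\<exists>r. \<forall>k. ((\<forall>m\<ge>r k. \<forall>n\<ge>r k. L2sq M (\<lambda>x. u m x - u n x) \<le> ennreal ((1/4) ^ k)) \<and> k \<le> r k)
        \<and> r k \<le> r (Suc k)"
    proof (rule dependent_nat_choice)
      obtain n0 where "\<forall>m\<ge>n0. \<forall>n\<ge>n0. L2sq M (\<lambda>x. u m x - u n x) \<le> ennreal ((1/4) ^ 0)"
        using cauchy[of "(1/4)^0"] by auto
      then show "\<exists>x. (\<forall>m\<ge>x. \<forall>n\<ge>x. L2sq M (\<lambda>xa. u m xa - u n xa) \<le> ennreal ((1/4) ^ 0)) \<and> 0 \<le> x" by auto
    next
      fix x k :: nat
      obtain n0 where n0: "\<forall>m\<ge>n0. \<forall>n\<ge>n0. L2sq M (\<lambda>x. u m x - u n x) \<le> ennreal ((1/4) ^ Suc k)"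
        using cauchy[of "(1/4)^Suc k"] by auto
      then show "\<exists>y. ((\<forall>m\<ge>y. \<forall>n\<ge>y. L2sq M (\<lambda>x. u m x - u n x) \<le> ennreal ((1/4) ^ Suc k)) \<and> Suc k \<le> y) \<and> x \<le> y"
        by (intro exI[of _ "n0 + x + Suc k"]) auto
    qed
    then show ?thesis by auto
  qed
  then obtain r where
    r: "\<And>k m n. m \<ge> r k \<Longrightarrow> n \<ge> r k \<Longrightarrow> L2sq M (\<lambda>x. u m x - u n x) \<le> ennreal ((1/4) ^ k)"
    and rk: "\<And>k. k \<le> r k" and rmono: "\<And>k. r k \<le> r (Suc k)" by blast
  define d where "d k x = u (r (Suc k)) x - u (r k) x" for k x
  have [measurable]: "d k \<in> borel_measurable M" for k unfolding d_def by measurable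
  have "(\<integral>\<^sup>+x. (\<Sum>k. ennreal (2 ^ k * (cmod (d k x))\<^sup>2)) \<partial>M) = (\<Sum>k. \<integral>\<^sup>+x. ennreal (2 ^ k * (cmod (d k x))\<^sup>2) \<partial>M)"
    by (rule nn_integral_suminf) auto
  also have "\<dots> = (\<Sum>k. ennreal (2 ^ k) * L2sq M (d k))"
    unfolding L2sq_def by (simp add: ennreal_mult nn_integral_cmult)
  also have "\<dots> \<le> (\<Sum>k. ennreal ((1/2) ^ k))"
  proof (intro suminf_le allI)
    fix k
    have "ennreal (2 ^ k) * L2sq M (d k) \<le> ennreal (2 ^ k) * ennreal ((1/4) ^ k)"
      unfolding d_def by (intro mult_left_mono r rmono) auto
    also have "\<dots> = ennreal (2 ^ k * (1/4) ^ k)" by (simp add: ennreal_mult)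
    also have "2 ^ k * (1/4) ^ k = (2 * (1/4)::real) ^ k" by (rule power_mult_distrib[symmetric])
    also have "\<dots> = (1/2) ^ k" by simp
    finally show "ennreal (2 ^ k) * L2sq M (d k) \<le> ennreal ((1/2)^k)" .
  qed auto
  also have "\<dots> = ennreal (\<Sum>k. (1/2) ^ k)"
    by (intro suminf_ennreal2) (auto intro!: summable_geometric)
  also have "\<dots> < \<infinity>" by simp
  finally have fin: "(\<integral>\<^sup>+x. (\<Sum>k. ennreal (2 ^ k * (cmod (d k x))\<^sup>2)) \<partial>M) \<noteq> \<infinity>" by simp
  have "AE x in M. (\<Sum>k. ennreal (2 ^ k * (cmod (d k x))\<^sup>2)) \<noteq> \<infinity>"
    by (rule nn_integral_noteq_infinite[OF _ fin]) measurable
  then have conv: "AE x in M. convergent (\<lambda>k. u (r k) x)"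
  proof eventually_elim
    case (elim x)
    then have "summable (\<lambda>k. cmod (d k x))"
      by (intro summable_norm_of_weighted_squares) (auto simp: top.not_eq_extremum)
    then have "summable (\<lambda>k. d k x)" by (rule summable_norm_cancel)
    then have "(\<lambda>n. \<Sum>k<n. d k x) \<longlonglongrightarrow> (\<Sum>k. d k x)" by (rule summable_LIMSEQ)
    then have "(\<lambda>n. u (r 0) x + (\<Sum>k<n. d k x)) \<longlonglongrightarrow> u (r 0) x + (\<Sum>k. d k x)"
      by (intro tendsto_intros)
    moreover have "u (r 0) x + (\<Sum>k<n. d k x) = u (r n) x" for n
      unfolding d_def by (subst sum_lessThan_telescope) simp
    ultimately show ?case by (auto simp: convergent_def)
  qed
  define g where "g x = lim (\<lambda>k. u (r k) x)" for x
  have g[measurable]: "g \<in> borel_measurable M" unfolding g_def by (intro borel_measurable_lim_metric) measurable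
  have lim: "AE x in M. (\<lambda>k. u (r k) x) \<longlonglongrightarrow> g x"
    using conv unfolding g_def by eventually_elim (simp add: convergent_LIMSEQ_iff)
  have close: "L2sq M (\<lambda>x. u n x - g x) \<le> ennreal ((1/4) ^ k)" if "n \<ge> r k" for n k
  proof -
    have "L2sq M (\<lambda>x. g x - u n x) \<le> ennreal ((1/4) ^ k)"
    proof (rule L2sq_Fatou[OF _ _ lim])
      show "\<forall>\<^sub>F j in sequentially. L2sq M (\<lambda>x. u (r j) x - u n x) \<le> ennreal ((1/4) ^ k)"
        using eventually_ge_at_top[of "r k"]
      proof eventually_elim
        case (elim j)
        then show ?case using rk[of j] that by (intro r) auto
      qed
    qed auto
    then show ?thesis by (subst L2sq_minus_commute)
  qed
  have "(\<lambda>n. L2sq M (\<lambda>x. u n x - g x)) \<longlonglongrightarrow> 0"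
  proof (rule order_tendstoI)
    fix e :: ennreal assume "0 < e"
    have "(\<lambda>k. ennreal ((1/4) ^ k)) \<longlonglongrightarrow> ennreal 0"
      by (intro tendsto_ennrealI LIMSEQ_power_zero) auto
    then have "eventually (\<lambda>k. ennreal ((1/4) ^ k) < e) sequentially"
      using \<open>0 < e\<close> by (auto dest: order_tendstoD(2))
    then obtain k where k: "ennreal ((1/4) ^ k) < e" by (auto simp: eventually_sequentially)
    show "\<forall>\<^sub>F n in sequentially. L2sq M (\<lambda>x. u n x - g x) < e"
      using eventually_ge_at_top[of "r k"]
    proof eventually_elim
      case (elim n)
      show ?case by (rule le_less_trans[OF close[OF elim] k])
    qed
  qed auto
  with g show ?thesis by (rule that)
qed

section \<open>The midpoint inequality on vertical lines\<close>

definition line_energy :: "(complex \<Rightarrow> complex) \<Rightarrow> real \<Rightarrow> ennreal" where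
  "line_energy f x = L2sq lborel (\<lambda>y. f (Complex x y))"

lemma nn_integral_Icc_continuous:
  fixes \<phi> :: "real \<Rightarrow> real"
  assumes "continuous_on {a..b} \<phi>" "\<And>x. x \<in> {a..b} \<Longrightarrow> 0 \<le> \<phi> x"
  shows "(\<integral>\<^sup>+x. ennreal (\<phi> x) * indicator {a..b} x \<partial>lborel) = ennreal (integral {a..b} \<phi>)"
  using assms by (intro nn_integral_has_integral_lebesgue' integrable_integral integrable_continuous_real)

lemma open_vertical_strip: "open {z. p < Re z \<and> Re z < q}"
  by (intro open_Collect_conj open_Collect_less continuous_intros)

lemma convex_vertical_strip: "convex {z. p < Re z \<and> Re z < q}"
  using convex_Int[OF convex_halfspace_Re_gt[of p] convex_halfspace_Re_lt[of q]]
  by (simp add: Int_def)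

lemma continuous_on_vertical_line:
  assumes "f holomorphic_on {z. p < Re z \<and> Re z < q}" "p < t" "t < q"
  shows "continuous_on S (\<lambda>y. f (Complex t y))"
  using assms
  by (intro continuous_on_compose2[OF holomorphic_on_imp_continuous_on[OF assms(1)]] continuous_intros) auto

text \<open>Cauchy's theorem for integrals over vertical lines, for a function that is controlled only through
  the integrals of \<open>|H|\<close>. The weight \<open>1 - (y/N)\<^sup>2\<close> vanishes at the ends of the segment, so after one integration by
  parts the derivative of the weighted integral in the direction of the real axis involves only the
  derivative of the weight, which is of size \<open>2/N\<close>. With uniformly bounded integrals of \<open>|H|\<close> the
  dependence on the line disappears as \<open>N\<close> grows.\<close>

lemma truncated_integral_shift:
  assumes hol: "H holomorphic_on {z. p < Re z \<and> Re z < q}"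
    and C: "\<And>t. p < t \<Longrightarrow> t < q \<Longrightarrow> integral {-N..N} (\<lambda>y. cmod (H (Complex t y))) \<le> C"
    and N: "N > 0" and t: "p < t1" "t1 < q" "p < t2" "t2 < q"
  defines "\<Psi> \<equiv> \<lambda>t. integral {-N..N} (\<lambda>y. of_real (1 - (y/N)\<^sup>2) * H (Complex t y))"
  shows "cmod (\<Psi> t1 - \<Psi> t2) \<le> 2 * C / N * \<bar>t1 - t2\<bar>"
proof -
  let ?U = "{z. p < Re z \<and> Re z < q}"
  define w where "w y = complex_of_real (1 - (y/N)\<^sup>2)" for y
  have shift: "z + \<i> * of_real y \<in> ?U" if "z \<in> ?U" for z y using that by simp
  have shift': "z + \<i> * of_real y = Complex (Re z) (Im z + y)" for z y by (simp add: complex_eq_iff)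
  have derH: "(H has_field_derivative deriv H z) (at z)" if "z \<in> ?U" for z
    using holomorphic_derivI[OF hol open_vertical_strip that] .
  have contH: "continuous_on ?U H" "continuous_on ?U (deriv H)"
    using hol holomorphic_deriv[OF hol open_vertical_strip] by (auto intro: holomorphic_on_imp_continuous_on)
  have contw: "continuous_on S w" for S unfolding w_def using N by (intro continuous_intros) auto
  define G where "G z = integral {-N..N} (\<lambda>y. w y * H (z + \<i> * of_real y))" for z
  define G' where "G' z = integral {-N..N} (\<lambda>y. w y * deriv H (z + \<i> * of_real y))" for z
  have contHz: "continuous_on S (\<lambda>y. H (z + \<i> * of_real y))"
       "continuous_on S (\<lambda>y. deriv H (z + \<i> * of_real y))" if "z \<in> ?U" for z and S :: "real set"
    using that by (auto intro!: continuous_on_compose2[OF contH(1)] continuous_on_compose2[OF contH(2)] continuous_intros)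
  have der: "(G has_field_derivative G' z) (at z within ?U)" if "z \<in> ?U" for z
    unfolding G_def G'_def box_real(2)[symmetric]
  proof (rule leibniz_rule_field_derivative[OF _ _ _ that convex_vertical_strip])
    fix z y assume z: "z \<in> ?U"
    have "((\<lambda>z. H (z + \<i> * of_real y)) has_field_derivative deriv H (z + \<i> * of_real y) * 1) (at z)"
      by (rule DERIV_chain2[where f = H and g = "\<lambda>z. z + \<i> * of_real y", OF derH[OF shift[OF z]]])
        (auto intro!: derivative_eq_intros)
    then show "((\<lambda>z. w y * H (z + \<i> * of_real y)) has_field_derivative w y * deriv H (z + \<i> * of_real y)) (at z within ?U)"
      by (auto intro!: DERIV_cmult intro: has_field_derivative_at_within)
  next
    fix z assume z: "z \<in> ?U"
    show "(\<lambda>y. w y * H (z + \<i> * of_real y)) integrable_on cbox (-N) N"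
      by (intro integrable_continuous continuous_intros contw contHz z)
  next
    have "continuous_on (?U \<times> cbox (-N) N) (\<lambda>p. deriv H (fst p + \<i> * of_real (snd p)))"
      by (rule continuous_on_compose2[OF contH(2)]) (auto intro!: continuous_intros)
    moreover have "continuous_on (?U \<times> cbox (-N) N) (\<lambda>p. w (snd p))"
      by (rule continuous_on_compose2[OF contw[of UNIV]]) (auto intro!: continuous_intros)
    ultimately show "continuous_on (?U \<times> cbox (-N) N) (\<lambda>(z, y). w y * deriv H (z + \<i> * of_real y))"
      unfolding case_prod_unfold by (intro continuous_intros)
  qed
  have bound: "cmod (G' z) \<le> 2 * C / N" if z: "z \<in> ?U" and Im: "Im z = 0" for z
  proof -
    \<comment> \<open>Integration by parts: the primitive is the weight times the function, zero at both ends.\<close>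
    have "((\<lambda>y. of_real (- 2 * y / N\<^sup>2) * H (z + \<i> * of_real y) + w y * (\<i> * deriv H (z + \<i> * of_real y)))
        has_integral (w N * H (z + \<i> * of_real N) - w (-N) * H (z + \<i> * of_real (-N)))) {-N..N}"
    proof (rule fundamental_theorem_of_calculus)
      fix y assume "y \<in> {-N..N}"
      have w': "(w has_vector_derivative of_real (- 2 * y / N\<^sup>2)) (at y within {-N..N})"
        unfolding w_def using N
        by (intro has_vector_derivative_of_real) (auto intro!: derivative_eq_intros simp: has_real_derivative_iff_has_vector_derivative[symmetric] power2_eq_square)
      have "((H \<circ> (\<lambda>y. z + \<i> * of_real y)) has_vector_derivative \<i> * deriv H (z + \<i> * of_real y)) (at y)"
      proof (rule field_vector_diff_chain_at)
        show "((\<lambda>y. z + \<i> * of_real y) has_vector_derivative \<i>) (at y)"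
          by (auto intro!: derivative_eq_intros has_vector_derivative_real_field)
        show "(H has_field_derivative deriv H (z + \<i> * of_real y)) (at (z + \<i> * of_real y))"
          by (rule derH[OF shift[OF z]])
      qed
      then have H': "((\<lambda>y. H (z + \<i> * of_real y)) has_vector_derivative \<i> * deriv H (z + \<i> * of_real y)) (at y within {-N..N})"
        by (simp add: o_def has_vector_derivative_at_within)
      show "((\<lambda>y. w y * H (z + \<i> * of_real y)) has_vector_derivative
          of_real (- 2 * y / N\<^sup>2) * H (z + \<i> * of_real y) + w y * (\<i> * deriv H (z + \<i> * of_real y))) (at y within {-N..N})"
        using has_vector_derivative_mult[OF w' H'] by (simp add: add.commute)
    qed (use N in auto)
    moreover have "w N = 0" "w (-N) = 0" using N by (auto simp: w_def)
    ultimately have parts: "((\<lambda>y. of_real (- 2 * y / N\<^sup>2) * H (z + \<i> * of_real y) + w y * (\<i> * deriv H (z + \<i> * of_real y))) has_integral 0) {-N..N}"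
      by simp
    have "((\<lambda>y. w y * deriv H (z + \<i> * of_real y)) has_integral G' z) {-N..N}"
      unfolding G'_def by (intro integrable_integral integrable_continuous_real continuous_intros contw contHz z)
    from has_integral_mult_right[OF this, of "\<i>"]
    have "((\<lambda>y. w y * (\<i> * deriv H (z + \<i> * of_real y))) has_integral \<i> * G' z) {-N..N}"
      by (simp add: mult.left_commute)
    from has_integral_diff[OF parts this]
    have "((\<lambda>y. of_real (- 2 * y / N\<^sup>2) * H (z + \<i> * of_real y)) has_integral 0 - \<i> * G' z) {-N..N}"
      by simp
    then have "- (\<i> * G' z) = integral {-N..N} (\<lambda>y. of_real (- 2 * y / N\<^sup>2) * H (z + \<i> * of_real y))"
      unfolding diff_0 by (rule integral_unique[symmetric])
    moreover have "cmod (integral {-N..N} (\<lambda>y. of_real (- 2 * y / N\<^sup>2) * H (z + \<i> * of_real y)))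
        \<le> integral {-N..N} (\<lambda>y. 2 / N * cmod (H (z + \<i> * of_real y)))"
    proof (rule integral_norm_bound_integral)
      fix y assume y: "y \<in> {-N..N}"
      have "\<bar>- 2 * y / N\<^sup>2\<bar> \<le> 2 / N" using y N by (auto simp: power2_eq_square abs_mult divide_simps)
      then show "cmod (of_real (- 2 * y / N\<^sup>2) * H (z + \<i> * of_real y)) \<le> 2 / N * cmod (H (z + \<i> * of_real y))"
        unfolding norm_mult norm_of_real by (rule mult_right_mono) auto
    qed (use N in \<open>auto intro!: integrable_continuous_real continuous_intros contHz[OF z]\<close>)
    moreover have "integral {-N..N} (\<lambda>y. 2 / N * cmod (H (z + \<i> * of_real y))) = 2 / N * integral {-N..N} (\<lambda>y. cmod (H (Complex (Re z) y)))"
      by (subst integral_mult_right) (simp add: shift' Im)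
    moreover have "2 / N * integral {-N..N} (\<lambda>y. cmod (H (Complex (Re z) y))) \<le> 2 / N * C"
      using z N by (intro mult_left_mono C) auto
    moreover have "cmod (- (\<i> * G' z)) = cmod (G' z)" by (simp add: norm_mult)
    ultimately show ?thesis using N by simp
  qed
  have \<Psi>: "\<Psi> t = G (of_real t)" for t unfolding \<Psi>_def G_def w_def by (simp add: shift')
  \<comment> \<open>The bound on the derivative is available on the real axis, so the mean value estimate is applied there.\<close>
  define S :: "complex set" where "S = of_real ` {p<..<q}"
  have S: "z \<in> ?U \<and> Im z = 0" if "z \<in> S" for z using that by (auto simp: S_def)
  have "cmod (G (of_real t1) - G (of_real t2)) \<le> 2 * C / N * cmod (of_real t1 - of_real t2)"
  proof (rule field_differentiable_bound[where S = S and f' = G'])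
    show "convex S" unfolding S_def by (intro convex_linear_image) (auto intro: bounded_linear.linear bounded_linear_of_real)
    show "(G has_field_derivative G' z) (at z within S)" if "z \<in> S" for z
      using der S[OF that] S by (blast intro: has_field_derivative_subset)
    show "cmod (G' z) \<le> 2 * C / N" if "z \<in> S" for z using bound S[OF that] by blast
  qed (use t in \<open>auto simp: S_def\<close>)
  then show ?thesis unfolding \<Psi> of_real_diff[symmetric] norm_of_real .
qed

lemma H2_stripD:
  assumes "f \<in> H2_strip b"
  shows "f holomorphic_on strip b"
    and "\<exists>M>0. \<forall>t. 0 < t \<longrightarrow> t < b \<longrightarrow> line_energy f t \<le> ennreal M"
proof -
  show "f holomorphic_on strip b" using assms by (simp add: H2_strip_def)
  let ?S = "SUP x\<in>{0<..<b}. line_energy f x"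
  have "?S < \<infinity>" using assms by (simp add: H2_strip_def line_energy_def L2sq_def)
  then obtain r where r: "0 \<le> r" "?S = ennreal r" by (cases ?S) auto
  have "line_energy f t \<le> ennreal (r + 1)" if "0 < t" "t < b" for t
  proof -
    have "line_energy f t \<le> ?S" using that by (intro SUP_upper) auto
    also have "\<dots> \<le> ennreal (r + 1)" unfolding r by (rule ennreal_leI) simp
    finally show ?thesis .
  qed
  then show "\<exists>M>0. \<forall>t. 0 < t \<longrightarrow> t < b \<longrightarrow> line_energy f t \<le> ennreal M"
    using r by (intro exI[of _ "r + 1"]) auto
qed

lemma H2_stripI:
  assumes "f holomorphic_on strip b" "\<And>t. 0 < t \<Longrightarrow> t < b \<Longrightarrow> line_energy f t \<le> ennreal M"
  shows "f \<in> H2_strip b"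
proof -
  have "(SUP x\<in>{0<..<b}. line_energy f x) \<le> ennreal M"
    using assms(2) by (intro SUP_least) auto
  also have "\<dots> < \<infinity>" by simp
  finally show ?thesis
    using assms(1) by (simp add: H2_strip_def line_energy_def L2sq_def)
qed

lemma interval_energy_le:
  assumes "f holomorphic_on strip b" "0 < t" "t < b" "line_energy f t \<le> ennreal M" "0 \<le> M"
  shows "integral {p..q} (\<lambda>y. (cmod (f (Complex t y)))\<^sup>2) \<le> M"
proof -
  have cont: "continuous_on {p..q} (\<lambda>y. (cmod (f (Complex t y)))\<^sup>2)"
    using assms by (intro continuous_intros continuous_on_vertical_line) (auto simp: strip_def)
  have "ennreal (integral {p..q} (\<lambda>y. (cmod (f (Complex t y)))\<^sup>2)) =
      (\<integral>\<^sup>+y. ennreal ((cmod (f (Complex t y)))\<^sup>2) * indicator {p..q} y \<partial>lborel)"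
    by (rule nn_integral_Icc_continuous[symmetric, OF cont]) simp
  also have "\<dots> \<le> line_energy f t"
    unfolding line_energy_def L2sq_def by (intro nn_integral_mono) (auto simp: indicator_def)
  also note assms(4)
  finally show ?thesis using assms(5) by simp
qed

lemma line_borel_measurable:
  assumes "f holomorphic_on strip b" "0 < t" "t < b"
  shows "(\<lambda>y. f (Complex t y)) \<in> borel_measurable borel"
  using assms by (intro borel_measurable_continuous_onI continuous_on_vertical_line) (auto simp: strip_def)

text \<open>The inner product of the traces on the lines \<open>x1\<close> and \<open>x2\<close> equals the squared norm on the line
  midway. Expanding the squared norm of the difference gives even an equality; the inequality is
  what survives the truncation with the least effort, and it suffices.\<close>

theorem line_energy_midpoint:
  assumes f: "f \<in> H2_strip b" and x: "0 < x1" "x1 < b" "0 < x2" "x2 < b"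
  shows "L2sq lborel (\<lambda>y. f (Complex x1 y) - f (Complex x2 y)) + 2 * line_energy f ((x1 + x2) / 2)
    \<le> line_energy f x1 + line_energy f x2"
proof -
  note hol = H2_stripD(1)[OF f]
  obtain M where M: "M > 0" "\<And>t. 0 < t \<Longrightarrow> t < b \<Longrightarrow> line_energy f t \<le> ennreal M"
    using H2_stripD(2)[OF f] by blast
  define s where "s = x1 + x2"
  define m where "m = s / 2"
  \<comment> \<open>In this strip both a point and its reflection in the line of abscissa \<open>m\<close> belong to \<open>strip b\<close>.\<close>
  define p where "p = max 0 (s - b)"
  define q where "q = min b s"
  have pq: "p < x1" "x1 < q" "p < x2" "x2 < q" "p < m" "m < q"
    using x unfolding p_def q_def s_def m_def by (auto simp: max_def min_def field_simps)
  have cont: "continuous_on S (\<lambda>y. f (Complex t y))" if "0 < t" "t < b" for t S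
    using hol that by (intro continuous_on_vertical_line) (auto simp: strip_def)
  have refl: "0 < t \<and> t < b \<and> 0 < s - t \<and> s - t < b" if "p < t" "t < q" for t
    using that unfolding p_def q_def by auto
  \<comment> \<open>On the line of abscissa \<open>x1\<close> this is the integrand of the inner product of the two traces.\<close>
  define H where "H z = f z * cnj (f (of_real s - cnj z))" for z
  have H_line: "H (Complex t y) = f (Complex t y) * cnj (f (Complex (s - t) y))" for t y
  proof -
    have "of_real s - cnj (Complex t y) = Complex (s - t) y" by (simp add: complex_eq_iff)
    then show ?thesis by (simp add: H_def)
  qed
  have holH: "H holomorphic_on {z. p < Re z \<and> Re z < q}"
  proof -
    have "(\<lambda>z. f (of_real s - z)) holomorphic_on cnj ` {z. p < Re z \<and> Re z < q}"
      using refl by (intro holomorphic_on_compose_gen[OF _ hol, unfolded o_def] holomorphic_intros) (auto simp: strip_def)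
    from holomorphic_on_compose_cnj_cnj[OF this open_vertical_strip]
    have "(\<lambda>z. cnj (f (of_real s - cnj z))) holomorphic_on {z. p < Re z \<and> Re z < q}"
      by (simp add: o_def)
    moreover have "f holomorphic_on {z. p < Re z \<and> Re z < q}"
      using refl by (intro holomorphic_on_subset[OF hol]) (auto simp: strip_def)
    ultimately show ?thesis unfolding H_def by (intro holomorphic_intros)
  qed
  have sq: "integral {a..c} (\<lambda>y. (cmod (f (Complex t y)))\<^sup>2) \<le> M" if "0 < t" "t < b" for t a c
    using that M by (intro interval_energy_le[OF hol]) auto
  have boundH: "integral {-N..N} (\<lambda>y. cmod (H (Complex t y))) \<le> M" if t: "p < t" "t < q" for t N
  proof -
    have st: "0 < t" "t < b" "0 < s - t" "s - t < b" using refl[OF t] by auto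
    have "integral {-N..N} (\<lambda>y. cmod (H (Complex t y))) \<le>
       integral {-N..N} (\<lambda>y. 1/2 * (cmod (f (Complex t y)))\<^sup>2 + 1/2 * (cmod (f (Complex (s - t) y)))\<^sup>2)"
    proof (rule integral_le)
      fix y
      show "cmod (H (Complex t y)) \<le> 1/2 * (cmod (f (Complex t y)))\<^sup>2 + 1/2 * (cmod (f (Complex (s - t) y)))\<^sup>2"
        using sum_squares_bound[of "cmod (f (Complex t y))" "cmod (f (Complex (s - t) y))"]
        by (simp add: H_line norm_mult)
    qed (auto simp: H_line intro!: integrable_continuous_real continuous_intros cont st)
    also have "\<dots> = 1/2 * integral {-N..N} (\<lambda>y. (cmod (f (Complex t y)))\<^sup>2) + 1/2 * integral {-N..N} (\<lambda>y. (cmod (f (Complex (s - t) y)))\<^sup>2)"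
      by (subst integral_add)
        (auto intro!: integrable_continuous_real continuous_intros cont st simp: integral_mult_right)
    also have "\<dots> \<le> M" using sq[OF st(1,2), of "-N" N] sq[OF st(3,4), of "-N" N] by simp
    finally show ?thesis .
  qed
  define G where "G y = (cmod (f (Complex x1 y) - f (Complex x2 y)))\<^sup>2 + 2 * (cmod (f (Complex m y)))\<^sup>2" for y
  have xm: "0 < m" "m < b" "0 < x1" "x1 < b" "0 < x2" "x2 < b" using x by (auto simp: m_def s_def)
  have contG: "continuous_on S G" for S unfolding G_def by (intro continuous_intros cont xm)
  have G0: "0 \<le> G y" for y by (simp add: G_def)
  obtain F1 where F1: "0 \<le> F1" "line_energy f x1 = ennreal F1"
    using M(2)[of x1] x by (cases "line_energy f x1") (auto simp: top_unique)
  obtain F2 where F2: "0 \<le> F2" "line_energy f x2 = ennreal F2"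
    using M(2)[of x2] x by (cases "line_energy f x2") (auto simp: top_unique)
  \<comment> \<open>The expanded square, with the line of integration of the cross term moved from \<open>x1\<close> to \<open>m\<close>.\<close>
  have trunc: "integral {-N..N} (\<lambda>y. (1 - (y/N)\<^sup>2) * G y) \<le> F1 + F2 + 4 * M * \<bar>x1 - m\<bar> / N" if N: "N > 0" for N
  proof -
    define w where "w y = 1 - (y/N)\<^sup>2" for y
    have contw: "continuous_on S w" for S unfolding w_def using N by (intro continuous_intros) auto
    have w1: "w y \<le> 1" for y by (simp add: w_def)
    define \<Psi> where "\<Psi> t = integral {-N..N} (\<lambda>y. of_real (1 - (y/N)\<^sup>2) * H (Complex t y))" for t
    have contH: "continuous_on S (\<lambda>y. H (Complex t y))" if "p < t" "t < q" for t S
      using holH that by (rule continuous_on_vertical_line)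
    have Re_\<Psi>: "((\<lambda>y. w y * Re (H (Complex t y))) has_integral Re (\<Psi> t)) {-N..N}" if t: "p < t" "t < q" for t
    proof -
      have "((\<lambda>y. of_real (w y) * H (Complex t y)) has_integral \<Psi> t) {-N..N}"
        unfolding \<Psi>_def w_def[symmetric]
        by (intro integrable_integral integrable_continuous_real continuous_intros contH t contw)
      from has_integral_linear[OF this bounded_linear_Re] show ?thesis by (simp add: o_def)
    qed
    have I: "((\<lambda>y. w y * (cmod (f (Complex t y)))\<^sup>2) has_integral integral {-N..N} (\<lambda>y. w y * (cmod (f (Complex t y)))\<^sup>2)) {-N..N}"
      if "0 < t" "t < b" for t
      using that by (intro integrable_integral integrable_continuous_real continuous_intros contw cont)
    have I_le: "integral {-N..N} (\<lambda>y. w y * (cmod (f (Complex t y)))\<^sup>2) \<le> F"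
      if t: "0 < t" "t < b" and F: "0 \<le> F" "line_energy f t = ennreal F" for t F
    proof -
      have "integral {-N..N} (\<lambda>y. w y * (cmod (f (Complex t y)))\<^sup>2) \<le> integral {-N..N} (\<lambda>y. (cmod (f (Complex t y)))\<^sup>2)"
        using mult_right_mono[OF w1, of "(cmod (f (Complex t y)))\<^sup>2" for y]
        by (intro integral_le integrable_continuous_real continuous_intros contw cont t) auto
      also have "\<dots> \<le> F" using F t by (intro interval_energy_le[OF hol]) auto
      finally show ?thesis .
    qed
    have expand: "w y * G y = w y * (cmod (f (Complex x1 y)))\<^sup>2 + w y * (cmod (f (Complex x2 y)))\<^sup>2
        - 2 * (w y * Re (H (Complex x1 y)) - w y * Re (H (Complex m y)))" for y
    proof -
      have polar: "(cmod (a - c))\<^sup>2 = (cmod a)\<^sup>2 + (cmod c)\<^sup>2 - 2 * Re (a * cnj c)" for a c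
        by (simp only: cmod_power2) (simp add: power2_eq_square algebra_simps)
      have Hm: "Re (H (Complex m y)) = (cmod (f (Complex m y)))\<^sup>2"
        unfolding H_line m_def by (simp only: cmod_power2) (simp add: power2_eq_square)
      have H1: "H (Complex x1 y) = f (Complex x1 y) * cnj (f (Complex x2 y))"
        unfolding H_line s_def by simp
      show ?thesis unfolding G_def polar Hm unfolding H1 by algebra
    qed
    have "((\<lambda>y. w y * G y) has_integral
        (integral {-N..N} (\<lambda>y. w y * (cmod (f (Complex x1 y)))\<^sup>2) + integral {-N..N} (\<lambda>y. w y * (cmod (f (Complex x2 y)))\<^sup>2)
          - 2 * (Re (\<Psi> x1) - Re (\<Psi> m)))) {-N..N}"
      unfolding expand by (intro has_integral_diff has_integral_add has_integral_mult_right I Re_\<Psi> xm pq)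
    then have "integral {-N..N} (\<lambda>y. w y * G y) \<le> F1 + F2 - 2 * Re (\<Psi> x1 - \<Psi> m)"
      using I_le[OF xm(3,4) F1] I_le[OF xm(5,6) F2] by (simp add: integral_unique)
    also have "- Re (\<Psi> x1 - \<Psi> m) \<le> 2 * M / N * \<bar>x1 - m\<bar>"
    proof -
      have "cmod (\<Psi> x1 - \<Psi> m) \<le> 2 * M / N * \<bar>x1 - m\<bar>"
        unfolding \<Psi>_def using boundH N pq by (intro truncated_integral_shift[OF holH]) auto
      then show ?thesis using abs_Re_le_cmod[of "\<Psi> x1 - \<Psi> m"] by linarith
    qed
    then have "F1 + F2 - 2 * Re (\<Psi> x1 - \<Psi> m) \<le> F1 + F2 + 2 * (2 * M / N * \<bar>x1 - m\<bar>)" by linarith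
    finally show ?thesis by (simp add: w_def)
  qed
  \<comment> \<open>The weights tend to \<open>1\<close> and the error term is of order \<open>1/N\<close>, so Fatou removes the truncation.\<close>
  define \<phi> where "\<phi> n y = ennreal ((1 - (y / real (Suc n))\<^sup>2) * G y) * indicator {- real (Suc n)..real (Suc n)} y" for n y
  have meas: "G \<in> borel_measurable borel" by (rule borel_measurable_continuous_onI[OF contG])
  have lim: "(\<lambda>n. \<phi> n y) \<longlonglongrightarrow> ennreal (G y)" for y
  proof -
    have "(\<lambda>n. y / real (Suc n)) \<longlonglongrightarrow> 0"
      using tendsto_mult_right_zero[OF LIMSEQ_inverse_real_of_nat, of y] by (simp add: divide_inverse)
    then have "(\<lambda>n. (1 - (y / real (Suc n))\<^sup>2) * G y) \<longlonglongrightarrow> (1 - 0\<^sup>2) * G y" by (intro tendsto_intros)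
    then have "(\<lambda>n. ennreal ((1 - (y / real (Suc n))\<^sup>2) * G y)) \<longlonglongrightarrow> ennreal (G y)" by (intro tendsto_ennrealI) simp
    moreover have "eventually (\<lambda>n. ennreal ((1 - (y / real (Suc n))\<^sup>2) * G y) = \<phi> n y) sequentially"
      using eventually_ge_at_top[of "nat \<lceil>\<bar>y\<bar>\<rceil>"]
    proof eventually_elim
      case (elim n)
      then have "\<bar>y\<bar> \<le> real (Suc n)" by linarith
      then have "y \<in> {- real (Suc n)..real (Suc n)}" by auto
      then show ?case unfolding \<phi>_def by (metis indicator_simps(1) mult.right_neutral)
    qed
    ultimately show ?thesis by (rule Lim_transform_eventually)
  qed
  have int_\<phi>: "(\<integral>\<^sup>+y. \<phi> n y \<partial>lborel) \<le> ennreal (F1 + F2 + 4 * M * \<bar>x1 - m\<bar> / real (Suc n))" for n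
  proof -
    have "(\<integral>\<^sup>+y. \<phi> n y \<partial>lborel) = ennreal (integral {- real (Suc n)..real (Suc n)} (\<lambda>y. (1 - (y / real (Suc n))\<^sup>2) * G y))"
      unfolding \<phi>_def
    proof (rule nn_integral_Icc_continuous)
      fix y assume "y \<in> {- real (Suc n)..real (Suc n)}"
      then have "\<bar>y / real (Suc n)\<bar> \<le> 1" by (auto simp: abs_le_iff divide_simps)
      then have "(y / real (Suc n))\<^sup>2 \<le> 1" by (simp only: abs_square_le_1)
      then show "0 \<le> (1 - (y / real (Suc n))\<^sup>2) * G y" using G0[of y] by simp
    qed (auto intro!: continuous_intros contG)
    also have "\<dots> \<le> ennreal (F1 + F2 + 4 * M * \<bar>x1 - m\<bar> / real (Suc n))" by (intro ennreal_leI trunc) simp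
    finally show ?thesis .
  qed
  have "(\<lambda>n. inverse (real (Suc n))) \<longlonglongrightarrow> 0" by (rule LIMSEQ_inverse_real_of_nat)
  then have "(\<lambda>n. F1 + F2 + 4 * M * \<bar>x1 - m\<bar> * inverse (real (Suc n))) \<longlonglongrightarrow> F1 + F2 + 4 * M * \<bar>x1 - m\<bar> * 0" by (intro tendsto_intros)
  then have limF: "(\<lambda>n. ennreal (F1 + F2 + 4 * M * \<bar>x1 - m\<bar> / real (Suc n))) \<longlonglongrightarrow> ennreal (F1 + F2)"
    by (intro tendsto_ennrealI) (simp add: divide_inverse)
  have [measurable]: "(\<lambda>y. f (Complex x1 y)) \<in> borel_measurable borel" "(\<lambda>y. f (Complex x2 y)) \<in> borel_measurable borel"
     "(\<lambda>y. f (Complex m y)) \<in> borel_measurable borel"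
    by (intro line_borel_measurable[OF hol] xm)+
  have "L2sq lborel (\<lambda>y. f (Complex x1 y) - f (Complex x2 y)) + 2 * line_energy f m = (\<integral>\<^sup>+y. ennreal (G y) \<partial>lborel)"
    unfolding L2sq_def line_energy_def G_def by (simp add: nn_integral_add nn_integral_cmult ennreal_plus ennreal_mult)
  also have "\<dots> = (\<integral>\<^sup>+y. liminf (\<lambda>n. \<phi> n y) \<partial>lborel)"
    by (intro nn_integral_cong lim_imp_Liminf[symmetric] lim) simp
  also have "\<dots> \<le> liminf (\<lambda>n. \<integral>\<^sup>+y. \<phi> n y \<partial>lborel)"
  proof (rule nn_integral_liminf)
    show "\<phi> n \<in> borel_measurable lborel" for n
      unfolding \<phi>_def[abs_def] using meas by (auto intro!: borel_measurable_times_ennreal borel_measurable_indicator)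
  qed
  also have "\<dots> \<le> liminf (\<lambda>n. ennreal (F1 + F2 + 4 * M * \<bar>x1 - m\<bar> / real (Suc n)))"
    by (intro Liminf_mono always_eventually allI int_\<phi>)
  also have "\<dots> = ennreal (F1 + F2)" by (intro lim_imp_Liminf limF) simp
  also have "\<dots> = line_energy f x1 + line_energy f x2" using F1 F2 by (simp add: ennreal_plus)
  finally show ?thesis by (simp add: m_def s_def)
qed

section \<open>Boundary values and pointwise bounds in the Hardy space of a strip\<close>

text \<open>Every point of \<open>[a, c]\<close> is the midpoint of an endpoint and another point of \<open>[a, c]\<close>, so the
  supremum \<open>S\<close> of \<open>F\<close> satisfies \<open>S \<le> (max (F a) (F c) + S) / 2\<close>.\<close>

lemma midpoint_convex_bounded_le_max:
  fixes F :: "real \<Rightarrow> real"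
  assumes mid: "\<And>s t. s \<in> {a..c} \<Longrightarrow> t \<in> {a..c} \<Longrightarrow> 2 * F ((s + t) / 2) \<le> F s + F t"
    and bdd: "bdd_above (F ` {a..c})" and x: "x \<in> {a..c}"
  shows "F x \<le> max (F a) (F c)"
proof -
  define S where "S = Sup (F ` {a..c})"
  have le_S: "F t \<le> S" if "t \<in> {a..c}" for t
    unfolding S_def using that bdd by (intro cSup_upper) auto
  have "F t \<le> (max (F a) (F c) + S) / 2" if t: "t \<in> {a..c}" for t
  proof (cases "2 * t - a \<le> c")
    case True
    then have "2 * F ((a + (2 * t - a)) / 2) \<le> F a + F (2 * t - a)" using t by (intro mid) auto
    then show ?thesis using le_S[of "2 * t - a"] True t by simp
  next
    case False
    then have "2 * F ((c + (2 * t - c)) / 2) \<le> F c + F (2 * t - c)" using t by (intro mid) auto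
    then show ?thesis using le_S[of "2 * t - c"] False t by simp
  qed
  then have "S \<le> (max (F a) (F c) + S) / 2"
    unfolding S_def using x by (intro cSup_least) auto
  then show ?thesis using le_S[OF x] by simp
qed

text \<open>If \<open>F\<close> is at most \<open>u\<close> at arbitrarily small points then it is at most \<open>u\<close> between any two of
  them, hence on a whole right neighbourhood of \<open>0\<close>. So the limit superior is the limit.\<close>

lemma quasiconvex_bounded_limit_at_right:
  fixes F :: "real \<Rightarrow> real"
  assumes "0 < b" and bd: "\<And>x. 0 < x \<Longrightarrow> x < b \<Longrightarrow> L \<le> F x \<and> F x \<le> M"
    and qc: "\<And>a x c. 0 < a \<Longrightarrow> a < x \<Longrightarrow> x < c \<Longrightarrow> c < b \<Longrightarrow> F x \<le> max (F a) (F c)"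
  shows "\<exists>l. (F \<longlongrightarrow> l) (at_right 0)"
proof -
  define G where "G d = Sup (F ` {0<..<d})" for d
  define l where "l = Inf (G ` {0<..<b})"
  have bdd: "bdd_above (F ` {0<..<d})" if "d < b" for d
    using bd that by (intro bdd_aboveI[of _ M]) force
  have F_le_G: "F x \<le> G d" if "0 < x" "x < d" "d < b" for x d
    unfolding G_def using that by (intro cSup_upper bdd) auto
  have G_ge: "L \<le> G d" if "0 < d" "d < b" for d
    using F_le_G[of "d/2" d] bd[of "d/2"] that by auto
  have bddG: "bdd_below (G ` {0<..<b})" using G_ge by (intro bdd_belowI[of _ L]) auto
  have l_le_G: "l \<le> G d" if "0 < d" "d < b" for d
    unfolding l_def using that by (intro cInf_lower bddG) auto
  have "(F \<longlongrightarrow> l) (at_right 0)"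
  proof (rule order_tendstoI)
    fix u assume "l < u"
    then obtain d where d: "0 < d" "d < b" "G d < u"
      unfolding l_def using \<open>0 < b\<close> by (subst (asm) cInf_less_iff[OF _ bddG]) auto
    show "eventually (\<lambda>x. F x < u) (at_right 0)"
      using d F_le_G unfolding eventually_at_right_field by (intro exI[of _ d]) (auto intro: le_less_trans)
  next
    fix u assume "u < l"
    show "eventually (\<lambda>x. u < F x) (at_right 0)"
    proof (rule ccontr)
      assume *: "\<not> eventually (\<lambda>x. u < F x) (at_right 0)"
      have small: "\<exists>a. 0 < a \<and> a < d \<and> F a \<le> u" if "0 < d" for d
        using * that unfolding eventually_at_right_field by (force simp: not_less)
      obtain d where d: "0 < d" "d < b" "F d \<le> u" using small[OF \<open>0 < b\<close>] by blast
      have "F x \<le> u" if x: "0 < x" "x < d" for x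
      proof -
        obtain a where a: "0 < a" "a < x" "F a \<le> u" using small[OF x(1)] by blast
        show ?thesis using qc[OF a(1,2) x(2) d(2)] a(3) d(3) by simp
      qed
      then have "G d \<le> u" unfolding G_def using d by (intro cSup_least) auto
      then show False using l_le_G[OF d(1,2)] \<open>u < l\<close> by simp
    qed
  qed
  then show ?thesis ..
qed

lemma line_energy_eq_ennreal:
  assumes f: "f \<in> H2_strip b" and t: "0 < t" "t < b"
  shows "line_energy f t = ennreal (enn2real (line_energy f t))"
proof -
  obtain M where "line_energy f t \<le> ennreal M" using H2_stripD(2)[OF f] t by blast
  then show ?thesis by (intro ennreal_enn2real[symmetric]) (auto simp: less_top[symmetric] top_unique)
qed

lemma enn2real_line_energy_midpoint:
  assumes f: "f \<in> H2_strip b" and x: "0 < x1" "x1 < b" "0 < x2" "x2 < b"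
  defines "F \<equiv> \<lambda>x. enn2real (line_energy f x)"
  shows "2 * F ((x1 + x2) / 2) \<le> F x1 + F x2"
    and "L2sq lborel (\<lambda>y. f (Complex x1 y) - f (Complex x2 y)) \<le> ennreal (F x1 + F x2 - 2 * F ((x1 + x2) / 2))"
proof -
  let ?D = "L2sq lborel (\<lambda>y. f (Complex x1 y) - f (Complex x2 y))"
  let ?m = "(x1 + x2) / 2"
  have m: "0 < ?m" "?m < b" using x by (auto simp: field_simps)
  have F: "line_energy f t = ennreal (F t)" if "0 < t" "t < b" for t
    unfolding F_def using line_energy_eq_ennreal[OF f that] .
  have F0: "0 \<le> F t" for t by (simp add: F_def)
  have *: "?D + ennreal (2 * F ?m) \<le> ennreal (F x1 + F x2)"
    using line_energy_midpoint[OF f x] F[OF x(1,2)] F[OF x(3,4)] F[OF m] F0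
    by (simp add: ennreal_plus ennreal_mult)
  have "ennreal (2 * F ?m) \<le> ennreal (F x1 + F x2)"
    using order_trans[OF add_increasing[OF _ order_refl] *] by simp
  then show le: "2 * F ?m \<le> F x1 + F x2" using F0 by (subst (asm) ennreal_le_iff) auto
  have "ennreal (F x1 + F x2) = ennreal (F x1 + F x2 - 2 * F ?m) + ennreal (2 * F ?m)"
    using le F0 by (subst ennreal_plus[symmetric]) auto
  with * have "ennreal (2 * F ?m) + ?D \<le> ennreal (2 * F ?m) + ennreal (F x1 + F x2 - 2 * F ?m)"
    by (simp only: add.commute)
  then show "?D \<le> ennreal (F x1 + F x2 - 2 * F ?m)"
    by (simp only: ennreal_add_left_cancel_le) simp
qed

lemma line_energy_le_max:
  assumes f: "f \<in> H2_strip b" and x: "0 < a" "a \<le> x" "x \<le> c" "c < b"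
  shows "line_energy f x \<le> max (line_energy f a) (line_energy f c)"
proof -
  define F where "F x = enn2real (line_energy f x)" for x
  have F: "line_energy f t = ennreal (F t)" if "0 < t" "t < b" for t
    unfolding F_def using line_energy_eq_ennreal[OF f that] .
  obtain M where M: "M > 0" "\<And>t. 0 < t \<Longrightarrow> t < b \<Longrightarrow> line_energy f t \<le> ennreal M"
    using H2_stripD(2)[OF f] by blast
  have "F x \<le> max (F a) (F c)"
  proof (rule midpoint_convex_bounded_le_max[of a c F])
    show "2 * F ((s + t) / 2) \<le> F s + F t" if "s \<in> {a..c}" "t \<in> {a..c}" for s t
      unfolding F_def using that x by (intro enn2real_line_energy_midpoint[OF f]) auto
    show "bdd_above (F ` {a..c})"
      unfolding F_def using M x by (intro bdd_aboveI[of _ M]) (auto intro!: enn2real_leI)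
  qed (use x in auto)
  then have "ennreal (F x) \<le> ennreal (max (F a) (F c))" by (rule ennreal_leI)
  also have "\<dots> = max (ennreal (F a)) (ennreal (F c))" by (simp add: max_def F_def)
  finally show ?thesis using F x by simp
qed

text \<open>As \<open>F\<close> has a limit at \<open>0\<close>, the combination \<open>F(s) + F(t) - 2 F((s + t)/2)\<close> tends to \<open>0\<close>, and it
  dominates the squared distance of the traces on the lines \<open>s\<close> and \<open>t\<close>.\<close>

theorem H2_strip_boundary_value_exists:
  assumes f: "f \<in> H2_strip b" and b: "0 < b"
  shows "\<exists>g. is_boundary_value f g"
proof -
  note hol = H2_stripD(1)[OF f]
  define F where "F x = enn2real (line_energy f x)" for x
  let ?D = "\<lambda>s t. L2sq lborel (\<lambda>y. f (Complex s y) - f (Complex t y))"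
  obtain M where M: "M > 0" "\<And>t. 0 < t \<Longrightarrow> t < b \<Longrightarrow> line_energy f t \<le> ennreal M"
    using H2_stripD(2)[OF f] by blast
  have Fline: "line_energy f t = ennreal (F t)" if "0 < t" "t < b" for t
    unfolding F_def using line_energy_eq_ennreal[OF f that] .
  have meas[measurable]: "(\<lambda>y. f (Complex t y)) \<in> borel_measurable borel" if "0 < t" "t < b" for t
    by (rule line_borel_measurable[OF hol that])
  have "\<exists>l. (F \<longlongrightarrow> l) (at_right 0)"
  proof (rule quasiconvex_bounded_limit_at_right[OF b])
    show "0 \<le> F x \<and> F x \<le> M" if "0 < x" "x < b" for x
      using M that by (auto simp: F_def intro!: enn2real_leI)
    fix a x c assume x: "0 < a" "a < x" "x < c" "c < b"
    have "ennreal (F x) \<le> max (ennreal (F a)) (ennreal (F c))"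
      using line_energy_le_max[OF f, of a x c] x Fline by simp
    also have "\<dots> = ennreal (max (F a) (F c))" by (simp add: max_def F_def)
    finally show "F x \<le> max (F a) (F c)" by (subst (asm) ennreal_le_iff) (auto simp: F_def le_max_iff_disj)
  qed
  then obtain l where l: "(F \<longlongrightarrow> l) (at_right 0)" ..
  have cauchy: "\<exists>d>0. d < b \<and> (\<forall>s t. 0 < s \<longrightarrow> s < d \<longrightarrow> 0 < t \<longrightarrow> t < d \<longrightarrow> ?D s t \<le> ennreal e)" if e: "e > 0" for e
  proof -
    have "eventually (\<lambda>x. dist (F x) l < e / 4) (at_right 0)" using tendstoD[OF l, of "e/4"] e by simp
    then obtain d0 where d0: "0 < d0" "\<And>x. 0 < x \<Longrightarrow> x < d0 \<Longrightarrow> \<bar>F x - l\<bar> < e / 4"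
      unfolding eventually_at_right_field dist_real_def by auto
    define d where "d = min d0 (b / 2)"
    have "?D s t \<le> ennreal e" if st: "0 < s" "s < d" "0 < t" "t < d" for s t
    proof -
      have "\<bar>F s - l\<bar> < e / 4" "\<bar>F t - l\<bar> < e / 4" "\<bar>F ((s + t) / 2) - l\<bar> < e / 4"
        using st d0(2)[of s] d0(2)[of t] d0(2)[of "(s + t) / 2"] by (auto simp: d_def)
      then have "F s + F t - 2 * F ((s + t) / 2) \<le> e" by linarith
      then have "ennreal (F s + F t - 2 * F ((s + t) / 2)) \<le> ennreal e" by (rule ennreal_leI)
      moreover have "?D s t \<le> ennreal (F s + F t - 2 * F ((s + t) / 2))"
        unfolding F_def using st b by (intro enn2real_line_energy_midpoint(2)[OF f]) (auto simp: d_def)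
      ultimately show ?thesis by (rule order_trans[rotated])
    qed
    moreover have "d > 0" "d < b" using d0(1) b by (auto simp: d_def)
    ultimately show ?thesis by blast
  qed
  define X where "X n = b / (real n + 2)" for n
  have X: "0 < X n" "X n < b" for n using b by (auto simp: X_def field_simps intro: add_pos_nonneg)
  have X0: "\<exists>n0. \<forall>n\<ge>n0. X n < d" if "d > 0" for d
  proof -
    have "X \<longlonglongrightarrow> 0" unfolding X_def by real_asymp
    then have "eventually (\<lambda>n. X n < d) sequentially" using that by (rule order_tendstoD(2))
    then show ?thesis by (simp add: eventually_sequentially)
  qed
  obtain g where g[measurable]: "g \<in> borel_measurable lborel"
    and lim: "(\<lambda>n. L2sq lborel (\<lambda>y. f (Complex (X n) y) - g y)) \<longlonglongrightarrow> 0"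
  proof (rule L2sq_complete[of "\<lambda>n y. f (Complex (X n) y)" lborel])
    show "(\<lambda>y. f (Complex (X n) y)) \<in> borel_measurable lborel" for n using meas[OF X] by simp
    fix e :: real assume "e > 0"
    from cauchy[OF this] X0 X show "\<exists>n0. \<forall>m\<ge>n0. \<forall>n\<ge>n0. ?D (X m) (X n) \<le> ennreal e" by meson
  qed
  have "((\<lambda>x. L2sq lborel (\<lambda>y. f (Complex x y) - g y)) \<longlongrightarrow> 0) (at_right 0)"
  proof (rule order_tendstoI)
    fix u :: ennreal assume "0 < u"
    then obtain v where v: "0 < v" "v < u" using dense by blast
    then obtain r where r: "0 < r" "ennreal r < u"
      by (cases v) (auto simp: top.not_eq_extremum[symmetric] top_unique)
    define e where "e = r / 4"
    have e: "e > 0" using r by (simp add: e_def)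
    obtain d where d: "d > 0" "d < b" and D: "\<And>s t. 0 < s \<Longrightarrow> s < d \<Longrightarrow> 0 < t \<Longrightarrow> t < d \<Longrightarrow> ?D s t \<le> ennreal e"
      using cauchy[OF e] by blast
    have "eventually (\<lambda>n. L2sq lborel (\<lambda>y. f (Complex (X n) y) - g y) < ennreal e) sequentially"
      using lim e by (intro order_tendstoD(2)) auto
    then obtain n where n: "X n < d" "L2sq lborel (\<lambda>y. f (Complex (X n) y) - g y) < ennreal e"
      using X0[OF d(1)] unfolding eventually_sequentially by (meson nle_le)
    have "L2sq lborel (\<lambda>y. f (Complex x y) - g y) < u" if x: "0 < x" "x < d" for x
    proof -
      have "L2sq lborel (\<lambda>y. f (Complex x y) - g y) \<le> 2 * ?D x (X n) + 2 * L2sq lborel (\<lambda>y. f (Complex (X n) y) - g y)"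
        using meas[of x] meas[OF X] x d by (intro L2sq_diff_le) auto
      also have "\<dots> \<le> 2 * ennreal e + 2 * ennreal e"
        using D[OF x X(1) n(1)] n(2) by (intro add_mono mult_left_mono) auto
      also have "\<dots> = ennreal r" using e by (simp add: e_def flip: ennreal_plus ennreal_numeral ennreal_mult)
      finally show ?thesis using r(2) by simp
    qed
    then show "eventually (\<lambda>x. L2sq lborel (\<lambda>y. f (Complex x y) - g y) < u) (at_right 0)"
      using d unfolding eventually_at_right_field by (intro exI[of _ d]) auto
  qed auto
  moreover have "L2sq lborel g < \<infinity>"
  proof -
    have "eventually (\<lambda>n. L2sq lborel (\<lambda>y. f (Complex (X n) y) - g y) < 1) sequentially"
      using lim by (intro order_tendstoD(2)) auto
    then obtain n where n: "L2sq lborel (\<lambda>y. f (Complex (X n) y) - g y) < 1" by (auto simp: eventually_sequentially)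
    have "L2sq lborel g \<le> 2 * L2sq lborel (\<lambda>y. g y - f (Complex (X n) y)) + 2 * line_energy f (X n)"
      unfolding line_energy_def using meas[OF X] by (intro L2sq_le_diff) auto
    also have "\<dots> \<le> 2 * 1 + 2 * ennreal M"
      using n M(2)[OF X] by (intro add_mono mult_left_mono) (auto simp: L2sq_minus_commute[of _ g])
    also have "\<dots> < \<infinity>" by (simp add: ennreal_mult_less_top)
    finally show ?thesis .
  qed
  ultimately show ?thesis
    using g unfolding is_boundary_value_def square_integrable_def L2sq_def by blast
qed

text \<open>On \<open>[a, c]\<close> the line energy is at most the larger end value; let \<open>a\<close> tend to \<open>0\<close>.\<close>

lemma line_energy_le_boundary:
  assumes f: "f \<in> H2_strip b" and g: "is_boundary_value f g" and x: "0 < x" "x < c" "c < b"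
  shows "line_energy f x \<le> 2 * L2sq lborel g + line_energy f c"
proof -
  have [measurable]: "g \<in> borel_measurable borel"
    using g by (simp add: is_boundary_value_def square_integrable_def)
  let ?D = "\<lambda>a. L2sq lborel (\<lambda>y. f (Complex a y) - g y)"
  have D0: "(?D \<longlongrightarrow> 0) (at_right 0)" using g by (simp add: is_boundary_value_def L2sq_def)
  have "((\<lambda>a. 2 * ?D a + (2 * L2sq lborel g + line_energy f c)) \<longlongrightarrow> 2 * 0 + (2 * L2sq lborel g + line_energy f c)) (at_right 0)"
    by (intro tendsto_add tendsto_const ennreal_tendsto_cmult D0) auto
  moreover have "eventually (\<lambda>a. line_energy f x \<le> 2 * ?D a + (2 * L2sq lborel g + line_energy f c)) (at_right 0)"
    unfolding eventually_at_right_field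
  proof (intro exI[of _ x] conjI allI impI x)
    fix a assume a: "0 < a" "a < x"
    have "line_energy f a \<le> 2 * ?D a + 2 * L2sq lborel g"
      unfolding line_energy_def using line_borel_measurable[OF H2_stripD(1)[OF f], of a] a x
      by (intro L2sq_le_diff) auto
    then have max: "max (line_energy f a) (line_energy f c) \<le> 2 * ?D a + (2 * L2sq lborel g + line_energy f c)"
      unfolding add.assoc[symmetric]
      by (intro max.boundedI add_increasing2[OF _ \<open>line_energy f a \<le> _\<close>] add_increasing[OF _ order_refl]) simp_all
    show "line_energy f x \<le> 2 * ?D a + (2 * L2sq lborel g + line_energy f c)"
      by (rule order_trans[OF line_energy_le_max[OF f, of a x c] max]) (use a x in auto)
  qed
  ultimately have "line_energy f x \<le> 2 * 0 + (2 * L2sq lborel g + line_energy f c)"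
    by (rule tendsto_lowerbound) simp
  then show ?thesis by simp
qed

lemma boundary_L2sq_le:
  assumes hol: "f holomorphic_on strip b" and b: "0 < b" and g: "is_boundary_value f g"
    and bound: "\<And>t. 0 < t \<Longrightarrow> t < b \<Longrightarrow> line_energy f t \<le> C"
  shows "L2sq lborel g \<le> 2 * C"
proof -
  have [measurable]: "g \<in> borel_measurable borel"
    using g by (simp add: is_boundary_value_def square_integrable_def)
  let ?D = "\<lambda>a. L2sq lborel (\<lambda>y. g y - f (Complex a y))"
  have D0: "(?D \<longlongrightarrow> 0) (at_right 0)"
    using g by (subst L2sq_minus_commute) (simp add: is_boundary_value_def L2sq_def)
  have "((\<lambda>a. 2 * ?D a + 2 * C) \<longlongrightarrow> 2 * 0 + 2 * C) (at_right 0)"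
    by (intro tendsto_add tendsto_const ennreal_tendsto_cmult D0) auto
  moreover have "eventually (\<lambda>a. L2sq lborel g \<le> 2 * ?D a + 2 * C) (at_right 0)"
    unfolding eventually_at_right_field
  proof (intro exI[of _ b] conjI allI impI b)
    fix a assume a: "0 < a" "a < b"
    have "L2sq lborel g \<le> 2 * ?D a + 2 * line_energy f a"
      unfolding line_energy_def using line_borel_measurable[OF hol a] by (intro L2sq_le_diff) auto
    also have "\<dots> \<le> 2 * ?D a + 2 * C" using bound[OF a] by (intro add_left_mono mult_left_mono) auto
    finally show "L2sq lborel g \<le> 2 * ?D a + 2 * C" .
  qed
  ultimately have "L2sq lborel g \<le> 2 * 0 + 2 * C" by (rule tendsto_lowerbound) simp
  then show ?thesis by simp
qed

text \<open>For a primitive \<open>P\<close> of \<open>f\<close>, the difference \<open>Q(w) = P(w + ih) - P(w)\<close> is an integral of \<open>f\<close> over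
  a vertical segment of length at most \<open>1\<close>, hence bounded by \<open>sqrt M\<close> on the whole strip. Cauchy's
  estimate for \<open>Q'\<close> at \<open>z\<close> says that \<open>f\<close> differs by at most \<open>sqrt M / d\<close> between \<open>z\<close> and
  \<open>z + ih\<close>, and averaging \<open>|f|\<^sup>2\<close> over \<open>h\<close> in \<open>[0, 1]\<close> bounds \<open>f(z)\<close>.\<close>

theorem H2_strip_point_bound:
  assumes hol: "f holomorphic_on strip b" and M: "M > 0"
    and bound: "\<And>t. 0 < t \<Longrightarrow> t < b \<Longrightarrow> line_energy f t \<le> ennreal M"
    and d: "d > 0" "d < Re z" "Re z + d < b"
  shows "(cmod (f z))\<^sup>2 \<le> 2 * M * (1 + 1 / d\<^sup>2)"
proof -
  have strip: "open (strip b)" "convex (strip b)"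
    unfolding strip_def by (rule open_vertical_strip convex_vertical_strip)+
  obtain P where P': "\<And>z. z \<in> strip b \<Longrightarrow> (P has_field_derivative f z) (at z within strip b)"
    using holomorphic_convex_primitive'[OF strip(2,1) hol] by blast
  then have P: "(P has_field_derivative f z) (at z)" if "z \<in> strip b" for z
    using that strip by (metis at_within_open)
  have Pd: "((\<lambda>z. P (z + c)) has_field_derivative f (z + c)) (at z)" if "z + c \<in> strip b" for z c
  proof -
    have "((\<lambda>z. z + c) has_field_derivative 1) (at z)" by (auto intro!: derivative_eq_intros)
    from DERIV_chain2[where f = P and g = "\<lambda>z. z + c", OF P[OF that] this] show ?thesis by simp
  qed
  have ball: "w \<in> strip b" if "w \<in> cball z d" for w
  proof -
    have "\<bar>Re z - Re w\<bar> \<le> d" using that abs_Re_le_cmod[of "z - w"] by (simp add: dist_norm)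
    then show ?thesis using d by (auto simp: strip_def)
  qed
  have zs: "z \<in> strip b" using ball d by simp
  have up: "w + \<i> * of_real h \<in> strip b" if "w \<in> strip b" for w h using that by (simp add: strip_def)
  have diff: "cmod (f (z + \<i> * of_real h) - f z) \<le> sqrt M / d" if h: "0 \<le> h" "h \<le> 1" for h
  proof -
    define Q where "Q w = P (w + \<i> * of_real h) - P w" for w
    have Q': "(Q has_field_derivative f (w + \<i> * of_real h) - f w) (at w)" if "w \<in> strip b" for w
      unfolding Q_def using that by (intro DERIV_diff P Pd up)
    have Q_bound: "cmod (Q w) \<le> sqrt M" if w: "w \<in> strip b" for w
    proof -
      have line: "w + \<i> * of_real y = Complex (Re w) (Im w + y)" for y by (simp add: complex_eq_iff)
      have "((\<lambda>y. \<i> * f (w + \<i> * of_real y)) has_integral (P (w + \<i> * of_real h) - P (w + \<i> * of_real 0))) {0..h}"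
      proof (rule fundamental_theorem_of_calculus)
        fix y
        have "((\<lambda>y. w + \<i> * of_real y) has_vector_derivative \<i>) (at y)"
          by (auto intro!: derivative_eq_intros has_vector_derivative_real_field)
        from field_vector_diff_chain_at[OF this P[OF up[OF w]]]
        show "((\<lambda>y. P (w + \<i> * of_real y)) has_vector_derivative \<i> * f (w + \<i> * of_real y)) (at y within {0..h})"
          by (simp add: o_def has_vector_derivative_at_within)
      qed (use h in auto)
      from integral_unique[OF this]
      have Q_eq: "Q w = integral {0..h} (\<lambda>y. \<i> * f (w + \<i> * of_real y))"
        by (simp add: Q_def)
      have cont: "continuous_on S (\<lambda>y. f (w + \<i> * of_real y))" for S :: "real set"
        using hol up[OF w] by (intro continuous_on_compose2[OF holomorphic_on_imp_continuous_on[OF hol]] continuous_intros) auto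
      have "cmod (Q w) \<le> integral {0..h} (\<lambda>y. sqrt M / 2 + (1 / (2 * sqrt M)) * (cmod (f (w + \<i> * of_real y)))\<^sup>2)"
        unfolding Q_eq
      proof (rule integral_norm_bound_integral)
        fix y
        let ?a = "cmod (f (w + \<i> * of_real y))"
        \<comment> \<open>A weighted arithmetic-geometric mean inequality in place of Cauchy-Schwarz.\<close>
        have "0 \<le> (sqrt M - ?a)\<^sup>2 / (2 * sqrt M)" using M by (intro divide_nonneg_pos) auto
        also have "\<dots> = sqrt M / 2 - ?a + (1 / (2 * sqrt M)) * ?a\<^sup>2"
          using M by (simp add: power2_diff field_simps power2_eq_square)
        finally show "cmod (\<i> * f (w + \<i> * of_real y)) \<le> sqrt M / 2 + (1 / (2 * sqrt M)) * ?a\<^sup>2"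
          by (simp add: norm_mult)
      qed (use M in \<open>auto intro!: integrable_continuous_real continuous_intros cont\<close>)
      also have "\<dots> = sqrt M / 2 * h + (1 / (2 * sqrt M)) * integral {0..h} (\<lambda>y. (cmod (f (w + \<i> * of_real y)))\<^sup>2)"
        using h M by (subst integral_add) (auto intro!: integrable_continuous_real continuous_intros cont simp: integral_mult_right)
      also have "integral {0..h} (\<lambda>y. (cmod (f (w + \<i> * of_real y)))\<^sup>2) = integral {Im w..Im w + h} (\<lambda>y. (cmod (f (Complex (Re w) y)))\<^sup>2)"
        using integral_shift_Icc_real[of 0 h "\<lambda>y. (cmod (f (Complex (Re w) y)))\<^sup>2" "Im w"]
        by (simp add: line o_def add.commute)
      also have "\<dots> \<le> M"
        using w M bound[of "Re w"] by (intro interval_energy_le[OF hol]) (auto simp: strip_def)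
      finally have "cmod (Q w) \<le> sqrt M / 2 * h + (1 / (2 * sqrt M)) * M"
        using M by (simp add: divide_right_mono)
      also have "(1 / (2 * sqrt M)) * M = sqrt M / 2" using M by (simp add: real_div_sqrt)
      also have "sqrt M / 2 * h + sqrt M / 2 \<le> sqrt M"
      proof -
        have "sqrt M / 2 * h \<le> sqrt M / 2 * 1" using h M by (intro mult_left_mono) auto
        then show ?thesis by linarith
      qed
      finally show ?thesis .
    qed
    have "Q holomorphic_on strip b" using Q' by (meson holomorphic_on_def field_differentiable_at_within field_differentiable_def)
    then have "Q holomorphic_on cball z d" by (rule holomorphic_on_subset) (use ball in auto)
    then have "cmod ((deriv ^^ 1) Q z) \<le> fact 1 * sqrt M / d ^ 1"
      using d ball by (intro Cauchy_inequality Q_bound holomorphic_on_imp_continuous_on)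
        (auto intro: holomorphic_on_subset simp: dist_norm)
    then show ?thesis using DERIV_imp_deriv[OF Q'[OF zs]] by simp
  qed
  have *: "(cmod (f z))\<^sup>2 \<le> 2 * (cmod (f (Complex (Re z) y)))\<^sup>2 + 2 * (M / d\<^sup>2)" if y: "y \<in> {Im z..Im z + 1}" for y
  proof -
    have "Complex (Re z) y = z + \<i> * of_real (y - Im z)" by (simp add: complex_eq_iff)
    then have "cmod (f (Complex (Re z) y) - f z) \<le> sqrt M / d" using diff[of "y - Im z"] y by simp
    then have "(cmod (f z - f (Complex (Re z) y)))\<^sup>2 \<le> (sqrt M / d)\<^sup>2"
      by (intro power_mono) (auto simp: norm_minus_commute)
    also have "\<dots> = M / d\<^sup>2" using M by (simp add: power_divide)
    finally show ?thesis using cmod_add_sq_le[of "f z - f (Complex (Re z) y)" "f (Complex (Re z) y)"] by simp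
  qed
  have cont: "continuous_on S (\<lambda>y. f (Complex (Re z) y))" for S
    using hol zs by (intro continuous_on_vertical_line) (auto simp: strip_def)
  have "(cmod (f z))\<^sup>2 = integral {Im z..Im z + 1} (\<lambda>y. (cmod (f z))\<^sup>2)" by simp
  also have "\<dots> \<le> integral {Im z..Im z + 1} (\<lambda>y. 2 * (cmod (f (Complex (Re z) y)))\<^sup>2 + 2 * (M / d\<^sup>2))"
    by (intro integral_le * integrable_continuous_real continuous_intros cont)
  also have "\<dots> = 2 * integral {Im z..Im z + 1} (\<lambda>y. (cmod (f (Complex (Re z) y)))\<^sup>2) + 2 * (M / d\<^sup>2)"
    by (subst integral_add) (auto intro!: integrable_continuous_real continuous_intros cont simp: integral_mult_right)
  also have "\<dots> \<le> 2 * M + 2 * (M / d\<^sup>2)"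
    using zs M bound[of "Re z"] interval_energy_le[OF hol, of "Re z" M "Im z" "Im z + 1"] by (auto simp: strip_def)
  finally show ?thesis by (simp add: algebra_simps)
qed

section \<open>Hilbert spaces of functions\<close>

lemma complex_function_subspace_iff:
  "complex_function_subspace V \<longleftrightarrow>
    (0 \<in> V \<and> (\<forall>f\<in>V. \<forall>g\<in>V. f + g \<in> V) \<and> (\<forall>c. \<forall>f\<in>V. (\<lambda>x. c * f x) \<in> V))"
proof -
  interpret module "\<lambda>(c::complex) (f::'a \<Rightarrow> complex) x. c * f x"
    by standard (auto simp: fun_eq_iff algebra_simps)
  show ?thesis unfolding complex_function_subspace_def subspace_def by (auto simp: zero_fun_def)
qed

text \<open>The discriminant criterion, used for the Cauchy-Schwarz inequality and again for the
  approximate minimizers in the Riesz representation theorem.\<close>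

lemma quadratic_nonneg_imp_linear_bound:
  fixes a b e :: real
  assumes "\<And>t. 0 \<le> t\<^sup>2 * a + 2 * t * b + e" "0 \<le> a"
  shows "b\<^sup>2 \<le> a * e"
proof (cases "a = 0")
  case True
  then have lin: "0 \<le> 2 * t * b + e" for t using assms(1)[of t] by simp
  have "b = 0"
  proof (rule ccontr)
    assume "b \<noteq> 0"
    then show False using lin[of "- (e + 1) / (2 * b)"] by (simp add: field_simps)
  qed
  then show ?thesis using True by simp
next
  case False
  then have "0 \<le> a * ((- b / a)\<^sup>2 * a + 2 * (- b / a) * b + e)"
    using assms(2) by (intro mult_nonneg_nonneg assms(1))
  also have "\<dots> = a * e - b\<^sup>2" using False by (simp add: field_simps power2_eq_square)
  finally show ?thesis by simp
qed

locale function_inner_product =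
  fixes V :: "('a \<Rightarrow> complex) set" and ip :: "('a \<Rightarrow> complex) \<Rightarrow> ('a \<Rightarrow> complex) \<Rightarrow> complex"
  assumes subspace: "complex_function_subspace V" and inner: "inner_product_on V ip"
begin

abbreviation scale :: "complex \<Rightarrow> ('a \<Rightarrow> complex) \<Rightarrow> 'a \<Rightarrow> complex" where
  "scale c f \<equiv> \<lambda>x. c * f x"

lemma mem_zero: "0 \<in> V" and mem_add: "f \<in> V \<Longrightarrow> g \<in> V \<Longrightarrow> f + g \<in> V"
  and mem_scale: "f \<in> V \<Longrightarrow> scale c f \<in> V"
  using subspace unfolding complex_function_subspace_iff by auto

lemma diff_eq: "f - g = f + scale (-1) g" by (simp add: fun_eq_iff)

lemma mem_diff: "f \<in> V \<Longrightarrow> g \<in> V \<Longrightarrow> f - g \<in> V"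
  unfolding diff_eq by (intro mem_add mem_scale)

lemmas ip_add_left = inner[unfolded inner_product_on_def, THEN conjunct1, rule_format]
  and ip_scale_left = inner[unfolded inner_product_on_def, THEN conjunct2, THEN conjunct1, rule_format]
  and ip_commute = inner[unfolded inner_product_on_def, THEN conjunct2, THEN conjunct2, THEN conjunct1, rule_format]
  and ip_pos = inner[unfolded inner_product_on_def, THEN conjunct2, THEN conjunct2, THEN conjunct2, rule_format]

lemma ip_add_right: "f \<in> V \<Longrightarrow> g \<in> V \<Longrightarrow> h \<in> V \<Longrightarrow> ip f (g + h) = ip f g + ip f h"
  using ip_commute[of "g + h" f] ip_commute[of g f] ip_commute[of h f] ip_add_left[of g h f] mem_add[of g h]
  by simp

lemma ip_scale_right: "f \<in> V \<Longrightarrow> g \<in> V \<Longrightarrow> ip f (scale c g) = cnj c * ip f g"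
  using ip_commute[of "scale c g" f] ip_commute[of g f] ip_scale_left[of g f c] mem_scale[of g c] by simp

lemma ip_zero: "ip 0 0 = 0"
  using ip_scale_left[OF mem_zero mem_zero, of 0] by (simp add: zero_fun_def)

lemma ip_self_nonneg: "f \<in> V \<Longrightarrow> 0 \<le> Re (ip f f)"
  using ip_pos[of f] ip_zero by (cases "f = 0") auto

lemma ip_norm_power2: "f \<in> V \<Longrightarrow> (ip_norm ip f)\<^sup>2 = Re (ip f f)"
  unfolding ip_norm_def using ip_self_nonneg by simp

lemma ip_norm_nonneg: "f \<in> V \<Longrightarrow> 0 \<le> ip_norm ip f"
  unfolding ip_norm_def using ip_self_nonneg by simp

lemma norm_add_scale_power2:
  assumes "f \<in> V" "g \<in> V"
  shows "(ip_norm ip (f + scale (of_real t) g))\<^sup>2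
    = (ip_norm ip f)\<^sup>2 + 2 * t * Re (ip f g) + t\<^sup>2 * (ip_norm ip g)\<^sup>2"
proof -
  have "ip (f + scale (of_real t) g) (f + scale (of_real t) g) =
     ip f f + of_real t * (ip f g + ip g f) + of_real (t\<^sup>2) * ip g g"
    using assms
    by (simp add: ip_add_left ip_add_right ip_scale_left ip_scale_right mem_add mem_scale power2_eq_square algebra_simps)
  moreover have "Re (ip g f) = Re (ip f g)" using ip_commute[of f g] assms by simp
  ultimately show ?thesis using assms by (simp add: ip_norm_power2 mem_add mem_scale flip: of_real_power)
qed

lemma norm_add_power2:
  assumes "f \<in> V" "g \<in> V"
  shows "(ip_norm ip (f + g))\<^sup>2 = (ip_norm ip f)\<^sup>2 + 2 * Re (ip f g) + (ip_norm ip g)\<^sup>2"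
  using norm_add_scale_power2[OF assms, of 1] by simp

lemma norm_diff_power2:
  assumes "f \<in> V" "g \<in> V"
  shows "(ip_norm ip (f - g))\<^sup>2 = (ip_norm ip f)\<^sup>2 - 2 * Re (ip f g) + (ip_norm ip g)\<^sup>2"
  using norm_add_scale_power2[OF assms, of "-1"] by (simp add: diff_eq)

lemma Re_ip_le:
  assumes "f \<in> V" "g \<in> V"
  shows "\<bar>Re (ip f g)\<bar> \<le> ip_norm ip f * ip_norm ip g"
proof -
  have "(Re (ip f g))\<^sup>2 \<le> (ip_norm ip g)\<^sup>2 * (ip_norm ip f)\<^sup>2"
  proof (rule quadratic_nonneg_imp_linear_bound)
    fix t :: real
    have "0 \<le> (ip_norm ip (f + scale (of_real t) g))\<^sup>2" by simp
    then show "0 \<le> t\<^sup>2 * (ip_norm ip g)\<^sup>2 + 2 * t * Re (ip f g) + (ip_norm ip f)\<^sup>2"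
      unfolding norm_add_scale_power2[OF assms] by simp
  qed simp
  then have "\<bar>Re (ip f g)\<bar>\<^sup>2 \<le> (ip_norm ip f * ip_norm ip g)\<^sup>2" by (simp add: power_mult_distrib mult.commute)
  then show ?thesis using assms by (intro power2_le_imp_le[of "\<bar>Re (ip f g)\<bar>"] mult_nonneg_nonneg ip_norm_nonneg)
qed

lemma ip_norm_triangle:
  assumes "f \<in> V" "g \<in> V"
  shows "ip_norm ip (f + g) \<le> ip_norm ip f + ip_norm ip g"
proof (rule power2_le_imp_le)
  show "(ip_norm ip (f + g))\<^sup>2 \<le> (ip_norm ip f + ip_norm ip g)\<^sup>2"
    unfolding norm_add_power2[OF assms] power2_sum using Re_ip_le[OF assms] by linarith
qed (use assms in \<open>auto intro: add_nonneg_nonneg ip_norm_nonneg\<close>)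

lemma ip_norm_minus_commute:
  assumes "f \<in> V" "g \<in> V"
  shows "ip_norm ip (f - g) = ip_norm ip (g - f)"
proof -
  have "g - f = scale (-1) (f - g)" by (simp add: fun_eq_iff)
  then have "ip (g - f) (g - f) = ip (scale (-1) (f - g)) (scale (-1) (f - g))" by (rule arg_cong)
  also have "\<dots> = ip (f - g) (f - g)"
    unfolding ip_scale_left[OF mem_diff[OF assms] mem_scale[OF mem_diff[OF assms]]]
      ip_scale_right[OF mem_diff[OF assms] mem_diff[OF assms]] by simp
  finally have "ip (g - f) (g - f) = ip (f - g) (f - g)" .
  then show ?thesis by (simp add: ip_norm_def)
qed

lemma ip_norm_eq_0_iff: "f \<in> V \<Longrightarrow> ip_norm ip f = 0 \<longleftrightarrow> f = 0"
  using ip_pos[of f] ip_zero by (cases "f = 0") (auto simp: ip_norm_def)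

text \<open>A metric on a carrier must be nonnegative and symmetric also outside it, where an inner
  product is arbitrary; letting it vanish there settles this.\<close>

lemma Metric_space_ip_norm:
  assumes outside: "\<And>f. f \<notin> V \<Longrightarrow> ip f f = 0"
  shows "Metric_space V (\<lambda>f g. ip_norm ip (f - g))"
proof
  show "0 \<le> ip_norm ip (f - g)" for f g
    using ip_norm_nonneg[of "f - g"] outside[of "f - g"] by (cases "f - g \<in> V") (auto simp: ip_norm_def)
  show "ip_norm ip (f - g) = ip_norm ip (g - f)" for f g
  proof (cases "f - g \<in> V")
    case True
    then show ?thesis using ip_norm_minus_commute[OF True mem_zero] by simp
  next
    case False
    then have "g - f \<notin> V" using mem_diff[OF mem_zero, of "g - f"] by auto
    then show ?thesis using False outside by (simp add: ip_norm_def)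
  qed
  show "(ip_norm ip (f - g) = 0) = (f = g)" if "f \<in> V" "g \<in> V" for f g
    using that by (simp add: ip_norm_eq_0_iff mem_diff)
  show "ip_norm ip (f - h) \<le> ip_norm ip (f - g) + ip_norm ip (g - h)" if "f \<in> V" "g \<in> V" "h \<in> V" for f g h
    using ip_norm_triangle[of "f - g" "g - h"] that by (simp add: mem_diff)
qed

text \<open>Stated for squared norms, so that it transfers directly to integrals of squares.\<close>

definition square_cauchy :: "(nat \<Rightarrow> 'a \<Rightarrow> complex) \<Rightarrow> bool" where
  "square_cauchy \<sigma> \<longleftrightarrow> (\<forall>n. \<sigma> n \<in> V) \<and>
    (\<forall>e>0. \<exists>N. \<forall>m\<ge>N. \<forall>n\<ge>N. (ip_norm ip (\<sigma> m - \<sigma> n))\<^sup>2 \<le> e)"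

lemma mcomplete_ip_norm:
  assumes outside: "\<And>f. f \<notin> V \<Longrightarrow> ip f f = 0"
    and complete: "\<And>\<sigma>. square_cauchy \<sigma> \<Longrightarrow> \<exists>k\<in>V. (\<lambda>n. ip_norm ip (\<sigma> n - k)) \<longlonglongrightarrow> 0"
  shows "Metric_space.mcomplete V (\<lambda>f g. ip_norm ip (f - g))"
proof -
  interpret metric: Metric_space V "\<lambda>f g. ip_norm ip (f - g)"
    by (rule Metric_space_ip_norm) (rule outside)
  show ?thesis
    unfolding metric.mcomplete_def
  proof (intro allI impI)
    fix \<sigma> assume "metric.MCauchy \<sigma>"
    then have mem: "\<And>n. \<sigma> n \<in> V"
      and cauchy: "\<And>\<epsilon>. \<epsilon> > 0 \<Longrightarrow> \<exists>N. \<forall>m\<ge>N. \<forall>n\<ge>N. ip_norm ip (\<sigma> m - \<sigma> n) < \<epsilon>"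
      unfolding metric.MCauchy_def by auto
    have "\<exists>N. \<forall>m\<ge>N. \<forall>n\<ge>N. (ip_norm ip (\<sigma> m - \<sigma> n))\<^sup>2 \<le> e" if e: "e > 0" for e
    proof -
      obtain N where N: "\<And>m n. m \<ge> N \<Longrightarrow> n \<ge> N \<Longrightarrow> ip_norm ip (\<sigma> m - \<sigma> n) < sqrt e"
        using cauchy[of "sqrt e"] e by auto
      have "(ip_norm ip (\<sigma> m - \<sigma> n))\<^sup>2 \<le> e" if "m \<ge> N" "n \<ge> N" for m n
        using power_mono[OF less_imp_le[OF N[OF that]], of 2] e ip_norm_nonneg[OF mem_diff[OF mem mem], of m n]
        by simp
      then show ?thesis by blast
    qed
    then have "square_cauchy \<sigma>" using mem by (auto simp: square_cauchy_def)
    then obtain k where k: "k \<in> V" "(\<lambda>n. ip_norm ip (\<sigma> n - k)) \<longlonglongrightarrow> 0" using complete by blast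
    have "\<exists>N. \<forall>n\<ge>N. \<sigma> n \<in> V \<and> ip_norm ip (\<sigma> n - k) < \<epsilon>" if "\<epsilon> > 0" for \<epsilon>
      using order_tendstoD(2)[OF k(2) that] mem by (auto simp: eventually_sequentially)
    then show "\<exists>x. limitin metric.mtopology \<sigma> x sequentially"
      using k(1) by (auto simp: metric.limit_metric_sequentially)
  qed
qed

text \<open>The representing vector of \<open>L\<close> minimizes \<open>J(f) = \<parallel>f\<parallel>\<^sup>2 - 2 Re (L f)\<close>, which is bounded below. By the
  parallelogram law a minimizing sequence is Cauchy. That a small real multiple of \<open>g\<close> cannot lower
  \<open>J\<close> by more than \<open>1/(n+1)\<close> bounds \<open>Re (g, f_n) - Re (L g)\<close>, so equality of real parts holds in the
  limit; imaginary parts follow by passing from \<open>g\<close> to \<open>-\<i> g\<close>.\<close>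

theorem Riesz_representation:
  assumes complete: "\<And>\<sigma>. square_cauchy \<sigma> \<Longrightarrow> \<exists>k\<in>V. (\<lambda>n. ip_norm ip (\<sigma> n - k)) \<longlonglongrightarrow> 0"
    and add: "\<And>f g. f \<in> V \<Longrightarrow> g \<in> V \<Longrightarrow> L (f + g) = L f + L g"
    and scale: "\<And>c f. f \<in> V \<Longrightarrow> L (scale c f) = c * L f"
    and C: "C > 0" and bounded: "\<And>f. f \<in> V \<Longrightarrow> (cmod (L f))\<^sup>2 \<le> C * (ip_norm ip f)\<^sup>2"
  shows "\<exists>k\<in>V. \<forall>f\<in>V. L f = ip f k"
proof -
  define J where "J f = (ip_norm ip f)\<^sup>2 - 2 * Re (L f)" for f
  have J_lower: "- C \<le> J f" if f: "f \<in> V" for f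
  proof -
    let ?l = "cmod (L f)"
    have "0 \<le> (?l - C)\<^sup>2" by simp
    also have "\<dots> = ?l\<^sup>2 - C * (2 * ?l - C)" by (simp add: power2_eq_square algebra_simps)
    also have "\<dots> \<le> C * (ip_norm ip f)\<^sup>2 - C * (2 * ?l - C)" using bounded[OF f] by simp
    also have "\<dots> = C * ((ip_norm ip f)\<^sup>2 - 2 * ?l + C)" by (simp add: algebra_simps)
    finally have "0 \<le> (ip_norm ip f)\<^sup>2 - 2 * ?l + C" using C by (simp add: zero_le_mult_iff)
    then show ?thesis using complex_Re_le_cmod[of "L f"] unfolding J_def by linarith
  qed
  define I where "I = Inf (J ` V)"
  have bddJ: "bdd_below (J ` V)" using J_lower by (intro bdd_belowI[of _ "- C"]) auto
  have I_le: "I \<le> J f" if "f \<in> V" for f unfolding I_def using that bddJ by (intro cInf_lower) auto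
  have "\<exists>f\<in>V. J f < I + 1 / real (Suc n)" for n
  proof -
    have "Inf (J ` V) < I + 1 / real (Suc n)" unfolding I_def by simp
    then show ?thesis using mem_zero by (subst (asm) cInf_less_iff[OF _ bddJ]) auto
  qed
  then obtain \<sigma> where \<sigma>: "\<And>n. \<sigma> n \<in> V" "\<And>n. J (\<sigma> n) < I + 1 / real (Suc n)" by metis
  have ReL: "L (f + scale (of_real t) g) = L f + of_real t * L g" if "f \<in> V" "g \<in> V" for f g t
    using that by (simp add: add scale mem_scale)
  have close: "(ip_norm ip (\<sigma> m - \<sigma> n))\<^sup>2 \<le> 2 / real (Suc m) + 2 / real (Suc n)" for m n
  proof -
    let ?h = "scale (of_real (1/2)) (\<sigma> m + \<sigma> n)"
    have mem: "\<sigma> m + \<sigma> n \<in> V" using \<sigma>(1) by (intro mem_add)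
    have "(ip_norm ip ?h)\<^sup>2 = (1/2)\<^sup>2 * (ip_norm ip (\<sigma> m + \<sigma> n))\<^sup>2"
      using norm_add_scale_power2[OF mem_zero mem, of "1/2"] ip_scale_left[OF mem_zero mem, of 0] ip_zero
      by (simp add: zero_fun_def[symmetric] ip_norm_def)
    moreover have "Re (L ?h) = (Re (L (\<sigma> m)) + Re (L (\<sigma> n))) / 2"
      unfolding scale[OF mem] add[OF \<sigma>(1) \<sigma>(1)] by simp
    ultimately have "4 * J ?h = (ip_norm ip (\<sigma> m + \<sigma> n))\<^sup>2 - 4 * Re (L (\<sigma> m)) - 4 * Re (L (\<sigma> n))"
      unfolding J_def by (simp add: power2_eq_square)
    moreover have "(ip_norm ip (\<sigma> m - \<sigma> n))\<^sup>2 + (ip_norm ip (\<sigma> m + \<sigma> n))\<^sup>2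
        = 2 * (ip_norm ip (\<sigma> m))\<^sup>2 + 2 * (ip_norm ip (\<sigma> n))\<^sup>2"
      using \<sigma>(1) by (simp add: norm_add_power2 norm_diff_power2)
    ultimately have "(ip_norm ip (\<sigma> m - \<sigma> n))\<^sup>2 = 2 * J (\<sigma> m) + 2 * J (\<sigma> n) - 4 * J ?h"
      unfolding J_def by simp
    also have "\<dots> \<le> 2 * (I + 1 / real (Suc m)) + 2 * (I + 1 / real (Suc n)) - 4 * I"
    proof -
      have "2 * a + 2 * b - 4 * c \<le> 2 * (I + u) + 2 * (I + v) - 4 * I"
        if "a < I + u" "b < I + v" "I \<le> c" for a b c u v using that by simp
      from this[OF \<sigma>(2) \<sigma>(2) I_le[OF mem_scale[OF mem]]] show ?thesis .
    qed
    finally show ?thesis by simp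
  qed
  have "\<exists>k\<in>V. (\<lambda>n. ip_norm ip (\<sigma> n - k)) \<longlonglongrightarrow> 0"
  proof (rule complete, unfold square_cauchy_def, intro conjI allI impI \<sigma>(1))
    fix e :: real assume "e > 0"
    then obtain N where N: "1 / real (Suc N) < e / 4" using nat_approx_posE[of "e/4"] by auto
    have "(ip_norm ip (\<sigma> m - \<sigma> n))\<^sup>2 \<le> e" if "m \<ge> N" "n \<ge> N" for m n
    proof -
      have "1 / real (Suc m) \<le> 1 / real (Suc N)" "1 / real (Suc n) \<le> 1 / real (Suc N)"
        using that by (auto intro!: divide_left_mono)
      then show ?thesis using close[of m n] N by linarith
    qed
    then show "\<exists>N. \<forall>m\<ge>N. \<forall>n\<ge>N. (ip_norm ip (\<sigma> m - \<sigma> n))\<^sup>2 \<le> e" by blast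
  qed
  then obtain k where k: "k \<in> V" "(\<lambda>n. ip_norm ip (\<sigma> n - k)) \<longlonglongrightarrow> 0" by blast
  have Re_eq: "Re (L g) = Re (ip g k)" if g: "g \<in> V" for g
  proof -
    have bound: "(Re (ip g (\<sigma> n)) - Re (L g))\<^sup>2 \<le> (ip_norm ip g)\<^sup>2 * (1 / real (Suc n))" for n
    proof (rule quadratic_nonneg_imp_linear_bound)
      fix t :: real
      have "I \<le> J (\<sigma> n + scale (of_real t) g)" using \<sigma>(1) g by (intro I_le mem_add mem_scale)
      also have "\<dots> = J (\<sigma> n) + 2 * t * (Re (ip (\<sigma> n) g) - Re (L g)) + t\<^sup>2 * (ip_norm ip g)\<^sup>2"
        unfolding J_def norm_add_scale_power2[OF \<sigma>(1) g] ReL[OF \<sigma>(1) g] by (simp add: algebra_simps)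
      also have "Re (ip (\<sigma> n) g) = Re (ip g (\<sigma> n))" using ip_commute[OF g \<sigma>(1)] by simp
      finally show "0 \<le> t\<^sup>2 * (ip_norm ip g)\<^sup>2 + 2 * t * (Re (ip g (\<sigma> n)) - Re (L g)) + 1 / real (Suc n)"
        using \<sigma>(2)[of n] by simp
    qed simp
    have "(\<lambda>n. Re (ip g (\<sigma> n)) - Re (ip g k)) \<longlonglongrightarrow> 0"
    proof (rule Lim_null_comparison)
      show "(\<lambda>n. ip_norm ip g * ip_norm ip (\<sigma> n - k)) \<longlonglongrightarrow> 0" using tendsto_mult_right_zero[OF k(2)] .
      have "\<bar>Re (ip g (\<sigma> n)) - Re (ip g k)\<bar> \<le> ip_norm ip g * ip_norm ip (\<sigma> n - k)" for n
      proof -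
        have "ip g (\<sigma> n - k) = ip g (\<sigma> n) - ip g k"
          unfolding diff_eq ip_add_right[OF g \<sigma>(1) mem_scale[OF k(1)]] ip_scale_right[OF g k(1)] by simp
        then show ?thesis using Re_ip_le[OF g mem_diff[OF \<sigma>(1) k(1)], of n] by simp
      qed
      then show "\<forall>\<^sub>F n in sequentially. norm (Re (ip g (\<sigma> n)) - Re (ip g k)) \<le> ip_norm ip g * ip_norm ip (\<sigma> n - k)"
        by simp
    qed
    then have "(\<lambda>n. ((Re (ip g (\<sigma> n)) - Re (ip g k)) + (Re (ip g k) - Re (L g)))\<^sup>2) \<longlonglongrightarrow> (0 + (Re (ip g k) - Re (L g)))\<^sup>2"
      by (intro tendsto_intros)
    moreover have "(\<lambda>n. (ip_norm ip g)\<^sup>2 * (1 / real (Suc n))) \<longlonglongrightarrow> 0"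
      using tendsto_mult_right_zero[OF LIMSEQ_inverse_real_of_nat] by (simp add: divide_inverse)
    ultimately have "(0 + (Re (ip g k) - Re (L g)))\<^sup>2 \<le> 0"
      by (rule LIMSEQ_le) (use bound in auto)
    then show ?thesis by simp
  qed
  have "L f = ip f k" if f: "f \<in> V" for f
  proof (rule complex_eqI)
    show "Re (L f) = Re (ip f k)" by (rule Re_eq[OF f])
    have "Re (L (scale (-\<i>) f)) = Re (ip (scale (-\<i>) f) k)" by (rule Re_eq[OF mem_scale[OF f]])
    then show "Im (L f) = Im (ip f k)" unfolding ip_scale_left[OF f k(1)] scale[OF f] by simp
  qed
  with k(1) show ?thesis by blast
qed

lemma polarization_unique:
  assumes inner': "inner_product_on V ip'"
    and eq: "\<And>f. f \<in> V \<Longrightarrow> (ip_norm ip' f)\<^sup>2 = (ip_norm ip f)\<^sup>2"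
    and f: "f \<in> V" and g: "g \<in> V"
  shows "ip' f g = ip f g"
proof -
  interpret other: function_inner_product V ip' by standard (rule subspace, rule inner')
  have Re: "Re (ip' f g) = Re (ip f g)" if "f \<in> V" "g \<in> V" for f g
    using norm_add_power2[OF that] other.norm_add_power2[OF that] eq mem_add that by simp
  show ?thesis
  proof (rule complex_eqI)
    show "Re (ip' f g) = Re (ip f g)" by (rule Re[OF f g])
    show "Im (ip' f g) = Im (ip f g)"
      using Re[OF mem_scale[OF f] g, of "-\<i>"] unfolding ip_scale_left[OF f g] other.ip_scale_left[OF f g] by simp
  qed
qed

end

section \<open>The Hilbert space \<open>M2_omega\<close>\<close>

lemma borel_imp_measurable_omega:
  assumes "u \<in> borel_measurable borel"
  shows "u \<in> borel_measurable omega"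
  unfolding omega_def using assms by (intro measurable_restrict_space1) simp

lemma measurable_vertical_line: "Complex t \<in> borel \<rightarrow>\<^sub>M borel"
  unfolding Complex_eq by measurable

lemma L2sq_omega:
  assumes [measurable]: "u \<in> borel_measurable borel"
  shows "L2sq omega u = (\<Sum>n. ennreal (2^n/fact n) * L2sq lborel (\<lambda>y. u (Complex (real n/2) y)))"
  unfolding L2sq_def by (rule nn_integral_omega) measurable

lemma is_boundary_value_boundary_value:
  assumes "f \<in> H2_strip b" "0 < b"
  shows "is_boundary_value f (boundary_value f)"
  unfolding boundary_value_def using H2_strip_boundary_value_exists[OF assms] by (rule someI_ex)

lemma is_boundary_value_measurable:
  assumes "is_boundary_value f g"
  shows "g \<in> borel_measurable borel"
  using assms by (simp add: is_boundary_value_def square_integrable_def)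

lemma H2_strip_lincomb:
  assumes f: "f \<in> H2_strip b" and g: "g \<in> H2_strip b"
  shows "(\<lambda>z. c * f z + g z) \<in> H2_strip b"
proof -
  obtain M where M: "M > 0" "\<And>t. 0 < t \<Longrightarrow> t < b \<Longrightarrow> line_energy f t \<le> ennreal M"
    using H2_stripD(2)[OF f] by blast
  obtain M' where M': "M' > 0" "\<And>t. 0 < t \<Longrightarrow> t < b \<Longrightarrow> line_energy g t \<le> ennreal M'"
    using H2_stripD(2)[OF g] by blast
  note hol = H2_stripD(1)[OF f] H2_stripD(1)[OF g]
  show ?thesis
  proof (rule H2_stripI)
    show "(\<lambda>z. c * f z + g z) holomorphic_on strip b" using hol by (intro holomorphic_intros)
    fix t assume t: "0 < t" "t < b"
    have [measurable]: "(\<lambda>y. f (Complex t y)) \<in> borel_measurable borel" "(\<lambda>y. g (Complex t y)) \<in> borel_measurable borel"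
      using line_borel_measurable hol t by blast+
    have "line_energy (\<lambda>z. c * f z + g z) t \<le> 2 * (ennreal ((cmod c)\<^sup>2) * line_energy f t) + 2 * line_energy g t"
      unfolding line_energy_def by (subst L2sq_cmult[symmetric]) (auto intro!: L2sq_add_le)
    also have "\<dots> \<le> 2 * (ennreal ((cmod c)\<^sup>2) * ennreal M) + 2 * ennreal M'"
      using M(2)[OF t] M'(2)[OF t] by (intro add_mono mult_left_mono) auto
    also have "\<dots> = ennreal (2 * ((cmod c)\<^sup>2 * M) + 2 * M')"
      using M M' by (simp add: ennreal_plus ennreal_mult)
    finally show "line_energy (\<lambda>z. c * f z + g z) t \<le> ennreal (2 * ((cmod c)\<^sup>2 * M) + 2 * M')" .
  qed
qed

lemma is_boundary_value_lincomb:
  assumes f: "f \<in> H2_strip b" and g: "g \<in> H2_strip b" and b: "0 < b"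
    and u: "is_boundary_value f u" and v: "is_boundary_value g v"
  shows "is_boundary_value (\<lambda>z. c * f z + g z) (\<lambda>y. c * u y + v y)"
proof -
  have [measurable]: "u \<in> borel_measurable borel" "v \<in> borel_measurable borel"
    using u v is_boundary_value_measurable by auto
  have fin: "L2sq lborel u < \<infinity>" "L2sq lborel v < \<infinity>"
    and lim: "((\<lambda>x. L2sq lborel (\<lambda>y. f (Complex x y) - u y)) \<longlongrightarrow> 0) (at_right 0)"
             "((\<lambda>x. L2sq lborel (\<lambda>y. g (Complex x y) - v y)) \<longlongrightarrow> 0) (at_right 0)"
    using u v by (simp_all add: is_boundary_value_def square_integrable_def L2sq_def)
  have "L2sq lborel (\<lambda>y. c * u y + v y) \<le> 2 * L2sq lborel (\<lambda>y. c * u y) + 2 * L2sq lborel v"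
    by (rule L2sq_add_le) auto
  also have "\<dots> < \<infinity>" using fin by (simp add: L2sq_cmult ennreal_mult_less_top)
  finally have "L2sq lborel (\<lambda>y. c * u y + v y) < \<infinity>" .
  moreover have "((\<lambda>x. L2sq lborel (\<lambda>y. (c * f (Complex x y) + g (Complex x y)) - (c * u y + v y))) \<longlongrightarrow> 0) (at_right 0)"
  proof (rule tendsto_sandwich[OF _ _ tendsto_const])
    have "((\<lambda>x. 2 * (ennreal ((cmod c)\<^sup>2) * L2sq lborel (\<lambda>y. f (Complex x y) - u y)) + 2 * L2sq lborel (\<lambda>y. g (Complex x y) - v y))
      \<longlongrightarrow> 2 * (ennreal ((cmod c)\<^sup>2) * 0) + 2 * 0) (at_right 0)"
      by (intro tendsto_add ennreal_tendsto_cmult lim) (auto simp: less_top)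
    then show "((\<lambda>x. 2 * (ennreal ((cmod c)\<^sup>2) * L2sq lborel (\<lambda>y. f (Complex x y) - u y)) + 2 * L2sq lborel (\<lambda>y. g (Complex x y) - v y))
      \<longlongrightarrow> 0) (at_right 0)" by simp
    show "\<forall>\<^sub>F x in at_right 0. L2sq lborel (\<lambda>y. (c * f (Complex x y) + g (Complex x y)) - (c * u y + v y)) \<le>
       2 * (ennreal ((cmod c)\<^sup>2) * L2sq lborel (\<lambda>y. f (Complex x y) - u y)) + 2 * L2sq lborel (\<lambda>y. g (Complex x y) - v y)"
      unfolding eventually_at_right_field
    proof (intro exI[of _ b] conjI allI impI b)
      fix x assume x: "0 < x" "x < b"
      have [measurable]: "(\<lambda>y. f (Complex x y)) \<in> borel_measurable borel" "(\<lambda>y. g (Complex x y)) \<in> borel_measurable borel"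
        using line_borel_measurable H2_stripD(1) f g x by blast+
      have "L2sq lborel (\<lambda>y. (c * f (Complex x y) + g (Complex x y)) - (c * u y + v y)) =
        L2sq lborel (\<lambda>y. c * (f (Complex x y) - u y) + (g (Complex x y) - v y))" by (simp add: algebra_simps)
      also have "\<dots> \<le> 2 * (ennreal ((cmod c)\<^sup>2) * L2sq lborel (\<lambda>y. f (Complex x y) - u y)) + 2 * L2sq lborel (\<lambda>y. g (Complex x y) - v y)"
        by (subst L2sq_cmult[symmetric]) (auto intro!: L2sq_add_le)
      finally show "L2sq lborel (\<lambda>y. (c * f (Complex x y) + g (Complex x y)) - (c * u y + v y)) \<le>
        2 * (ennreal ((cmod c)\<^sup>2) * L2sq lborel (\<lambda>y. f (Complex x y) - u y)) + 2 * L2sq lborel (\<lambda>y. g (Complex x y) - v y)" .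
    qed
  qed simp
  ultimately show ?thesis
    by (simp add: is_boundary_value_def square_integrable_def L2sq_def)
qed

lemma H2_strip_zero: "(\<lambda>z. 0) \<in> H2_strip b"
  by (rule H2_stripI[of _ _ 0]) (simp_all add: line_energy_def L2sq_def)

text \<open>The difference of two boundary values of \<open>f\<close> is a boundary value of \<open>0\<close>.\<close>

lemma boundary_value_unique:
  assumes f: "f \<in> H2_strip b" and b: "0 < b" and u: "is_boundary_value f u" and v: "is_boundary_value f v"
  shows "AE y in lborel. u y = v y"
proof -
  have [measurable]: "u \<in> borel_measurable borel" "v \<in> borel_measurable borel"
    using u v is_boundary_value_measurable by auto
  have "is_boundary_value (\<lambda>z. -1 * f z + f z) (\<lambda>y. -1 * v y + u y)"
    by (rule is_boundary_value_lincomb[OF f f b v u])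
  then have "is_boundary_value (\<lambda>z. 0) (\<lambda>y. u y - v y)" by simp
  then have "L2sq lborel (\<lambda>y. u y - v y) \<le> 2 * 0"
    by (rule boundary_L2sq_le[where b = 1, rotated 2]) (auto simp: line_energy_def L2sq_def)
  then show ?thesis by (simp add: L2sq_eq_0_iff)
qed

lemma with_boundary_line:
  "with_boundary f (Complex (real n / 2) y) = (if n = 0 then boundary_value f y else f (Complex (real n / 2) y))"
  by (simp add: with_boundary_def)

lemma half_plane_function_measurable:
  assumes "f holomorphic_on right_half_plane" "\<And>z. z \<notin> right_half_plane \<Longrightarrow> f z = 0"
  shows "f \<in> borel_measurable borel"
proof -
  have "open right_half_plane" unfolding right_half_plane_def by (rule open_halfspace_Re_gt)
  then have "(\<lambda>z. indicator right_half_plane z *\<^sub>R f z) \<in> borel_measurable borel"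
    using assms(1) by (intro borel_measurable_continuous_on_indicator holomorphic_on_imp_continuous_on) auto
  also have "(\<lambda>z. indicator right_half_plane z *\<^sub>R f z) = f" using assms(2) by (auto simp: fun_eq_iff indicator_def)
  finally show ?thesis .
qed

lemma with_boundary_measurable:
  assumes "f holomorphic_on right_half_plane" "\<And>z. z \<notin> right_half_plane \<Longrightarrow> f z = 0"
    and "f \<in> H2_strip b" "0 < b"
  shows "with_boundary f \<in> borel_measurable borel"
proof -
  have [measurable]: "f \<in> borel_measurable borel" using assms by (intro half_plane_function_measurable) auto
  have [measurable]: "boundary_value f \<in> borel_measurable borel"
    using is_boundary_value_measurable[OF is_boundary_value_boundary_value[OF assms(3,4)]] .
  show ?thesis unfolding with_boundary_def[abs_def] by measurable
qed

lemma M2_omegaD: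
  assumes "f \<in> M2_omega"
  shows "f holomorphic_on right_half_plane" "\<And>z. z \<notin> right_half_plane \<Longrightarrow> f z = 0"
    "\<And>b. b > 0 \<Longrightarrow> f \<in> H2_strip b" "L2sq omega (with_boundary f) < \<infinity>"
    "with_boundary f \<in> borel_measurable borel"
    "is_boundary_value f (boundary_value f)"
proof -
  show *: "f holomorphic_on right_half_plane" "\<And>z. z \<notin> right_half_plane \<Longrightarrow> f z = 0"
    "\<And>b. b > 0 \<Longrightarrow> f \<in> H2_strip b" "L2sq omega (with_boundary f) < \<infinity>"
    using assms by (auto simp: M2_omega_def square_integrable_def L2sq_def)
  show "with_boundary f \<in> borel_measurable borel" using with_boundary_measurable[OF *(1,2) *(3)[of 1]] by simp
  show "is_boundary_value f (boundary_value f)" using is_boundary_value_boundary_value[OF *(3)[of 1]] by simp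
qed

lemma M2_omegaI:
  assumes "f holomorphic_on right_half_plane" "\<And>z. z \<notin> right_half_plane \<Longrightarrow> f z = 0"
    "\<And>b. b > 0 \<Longrightarrow> f \<in> H2_strip b" "L2sq omega (with_boundary f) < \<infinity>"
  shows "f \<in> M2_omega"
proof -
  have "with_boundary f \<in> borel_measurable omega"
    using with_boundary_measurable[OF assms(1,2) assms(3)[of 1]] by (intro borel_imp_measurable_omega) simp
  with assms show ?thesis by (auto simp: M2_omega_def square_integrable_def L2sq_def)
qed

text \<open>Boundary values are chosen representatives, hence additive only up to null sets. This lemma
  confines that difficulty to the line \<open>n = 0\<close>; afterwards \<open>L\<^sup>2(\<omega>)\<close> does not see it.\<close>

lemma with_boundary_lincomb_AE:
  assumes f: "f \<in> M2_omega" and g: "g \<in> M2_omega"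
  shows "AE z in omega. with_boundary (\<lambda>z. c * f z + g z) z = c * with_boundary f z + with_boundary g z"
proof -
  note f' = M2_omegaD[OF f] and g' = M2_omegaD[OF g]
  let ?h = "\<lambda>z. c * f z + g z"
  have h: "?h \<in> H2_strip 1" using f'(3) g'(3) by (intro H2_strip_lincomb) auto
  have bh: "is_boundary_value ?h (boundary_value ?h)" using is_boundary_value_boundary_value[OF h] by simp
  have AE: "AE y in lborel. boundary_value ?h y = c * boundary_value f y + boundary_value g y"
    by (rule boundary_value_unique[OF h _ bh is_boundary_value_lincomb[where b = 1, OF _ _ _ f'(6) g'(6)]]) (use f'(3) g'(3) in auto)
  have [measurable]: "with_boundary f \<in> borel_measurable borel" "with_boundary g \<in> borel_measurable borel"
    "with_boundary ?h \<in> borel_measurable borel"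
    using f' g' h by (auto intro!: with_boundary_measurable[where b = 1] holomorphic_intros)
  let ?d = "\<lambda>z. with_boundary ?h z - (c * with_boundary f z + with_boundary g z)"
  have "L2sq lborel (\<lambda>y. ?d (Complex (real n / 2) y)) = 0" for n
  proof (cases "n = 0")
    case True
    have "L2sq lborel (\<lambda>y. ?d (Complex (real n / 2) y)) = L2sq lborel (\<lambda>y::real. 0)"
      by (rule L2sq_cong_AE) (use AE True in \<open>simp add: with_boundary_def\<close>)
    then show ?thesis by (simp add: L2sq_def)
  next
    case False
    then show ?thesis by (simp add: with_boundary_line L2sq_def)
  qed
  then have "L2sq omega ?d = 0" by (subst L2sq_omega) auto
  then show ?thesis by (subst (asm) L2sq_eq_0_iff) (auto intro!: borel_imp_measurable_omega)
qed

lemma M2_omega_lincomb: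
  assumes f: "f \<in> M2_omega" and g: "g \<in> M2_omega"
  shows "(\<lambda>z. c * f z + g z) \<in> M2_omega"
proof (rule M2_omegaI)
  note f' = M2_omegaD[OF f] and g' = M2_omegaD[OF g]
  have [measurable]: "with_boundary f \<in> borel_measurable omega" "with_boundary g \<in> borel_measurable omega"
    using f'(5) g'(5) by (auto intro: borel_imp_measurable_omega)
  show "(\<lambda>z. c * f z + g z) holomorphic_on right_half_plane" using f' g' by (intro holomorphic_intros)
  show "c * f z + g z = 0" if "z \<notin> right_half_plane" for z using f'(2) g'(2) that by simp
  show "(\<lambda>z. c * f z + g z) \<in> H2_strip b" if "b > 0" for b using f'(3) g'(3) that by (intro H2_strip_lincomb) auto
  have "L2sq omega (with_boundary (\<lambda>z. c * f z + g z)) = L2sq omega (\<lambda>z. c * with_boundary f z + with_boundary g z)"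
    by (rule L2sq_cong_AE[OF with_boundary_lincomb_AE[OF f g]])
  also have "\<dots> \<le> 2 * L2sq omega (\<lambda>z. c * with_boundary f z) + 2 * L2sq omega (with_boundary g)"
    by (rule L2sq_add_le) auto
  also have "\<dots> < \<infinity>" using f'(4) g'(4) by (simp add: L2sq_cmult ennreal_mult_less_top)
  finally show "L2sq omega (with_boundary (\<lambda>z. c * f z + g z)) < \<infinity>" .
qed

lemma M2_omega_zero: "0 \<in> M2_omega"
  unfolding zero_fun_def
proof (rule M2_omegaI)
  have z: "is_boundary_value (\<lambda>z. 0) (boundary_value (\<lambda>z. 0))"
    by (rule is_boundary_value_boundary_value[OF H2_strip_zero[of 1]]) simp
  then have "L2sq lborel (boundary_value (\<lambda>z. 0)) \<le> 2 * 0"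
    by (rule boundary_L2sq_le[where b = 1, rotated 2]) (auto simp: line_energy_def L2sq_def)
  then have "L2sq lborel (\<lambda>y. with_boundary (\<lambda>z. 0) (Complex (real n / 2) y)) = 0" for n
    unfolding with_boundary_line by (cases "n = 0") (auto simp: L2sq_def)
  moreover have "with_boundary (\<lambda>z. 0) \<in> borel_measurable borel"
    by (rule with_boundary_measurable[OF _ _ H2_strip_zero[of 1]]) auto
  ultimately have "L2sq omega (with_boundary (\<lambda>z. 0)) = 0" by (subst L2sq_omega) auto
  then show "L2sq omega (with_boundary (\<lambda>z. 0)) < \<infinity>" by simp
qed (auto intro: H2_strip_zero)

lemma M2_omega_subspace: "complex_function_subspace M2_omega"
  unfolding complex_function_subspace_iff
proof (intro conjI ballI allI M2_omega_zero)
  fix f g c assume f: "f \<in> M2_omega"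
  show "(\<lambda>z. c * f z) \<in> M2_omega" using M2_omega_lincomb[OF f M2_omega_zero, of c] by simp
  assume g: "g \<in> M2_omega"
  show "f + g \<in> M2_omega" using M2_omega_lincomb[OF f g, of 1] by (simp add: plus_fun_def)
qed

lemma with_boundary_diff_AE:
  assumes f: "f \<in> M2_omega" and g: "g \<in> M2_omega"
  shows "AE z in omega. with_boundary (f - g) z = with_boundary f z - with_boundary g z"
proof -
  have "f - g = (\<lambda>z. -1 * g z + f z)" by (simp add: fun_eq_iff)
  then show ?thesis using with_boundary_lincomb_AE[OF g f, of "-1"] by simp
qed

lemma M2_omega_diff: "f \<in> M2_omega \<Longrightarrow> g \<in> M2_omega \<Longrightarrow> f - g \<in> M2_omega"
  using M2_omega_lincomb[of g f "-1"] by (simp add: fun_diff_def)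

text \<open>The value \<open>0\<close> outside the space makes the induced distance symmetric and nonnegative on all
  functions.\<close>

definition omega_inner :: "(complex \<Rightarrow> complex) \<Rightarrow> (complex \<Rightarrow> complex) \<Rightarrow> complex" where
  "omega_inner f g = (if f \<in> M2_omega \<and> g \<in> M2_omega
     then \<integral>z. with_boundary f z * cnj (with_boundary g z) \<partial>omega else 0)"

lemma borel_measurable_cnj [measurable]:
  assumes "u \<in> borel_measurable M"
  shows "(\<lambda>z. cnj (u z)) \<in> borel_measurable M"
  by (rule measurable_compose[OF assms borel_measurable_continuous_onI[OF continuous_on_cnj[OF continuous_on_id]]])

lemma integrable_with_boundary_mult:
  assumes f: "f \<in> M2_omega" and g: "g \<in> M2_omega"
  shows "integrable omega (\<lambda>z. with_boundary f z * cnj (with_boundary g z))"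
proof -
  have [measurable]: "with_boundary f \<in> borel_measurable omega" "with_boundary g \<in> borel_measurable omega"
    using M2_omegaD(5) f g by (auto intro: borel_imp_measurable_omega)
  have "(\<integral>\<^sup>+z. ennreal (norm (with_boundary f z * cnj (with_boundary g z))) \<partial>omega)
     \<le> (\<integral>\<^sup>+z. ennreal ((cmod (with_boundary f z))\<^sup>2) + ennreal ((cmod (with_boundary g z))\<^sup>2) \<partial>omega)"
  proof (rule nn_integral_mono)
    fix z
    let ?a = "cmod (with_boundary f z)" and ?b = "cmod (with_boundary g z)"
    have "0 \<le> ?a * ?b" by simp
    then have "?a * ?b \<le> ?a\<^sup>2 + ?b\<^sup>2" using sum_squares_bound[of ?a ?b] by linarith
    then have "ennreal (?a * ?b) \<le> ennreal (?a\<^sup>2 + ?b\<^sup>2)" by (rule ennreal_leI)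
    then show "ennreal (norm (with_boundary f z * cnj (with_boundary g z))) \<le> ennreal (?a\<^sup>2) + ennreal (?b\<^sup>2)"
      by (simp add: norm_mult ennreal_plus)
  qed
  also have "\<dots> = L2sq omega (with_boundary f) + L2sq omega (with_boundary g)"
    unfolding L2sq_def by (rule nn_integral_add) auto
  also have "\<dots> < \<infinity>" using M2_omegaD(4)[OF f] M2_omegaD(4)[OF g] by simp
  finally have "(\<integral>\<^sup>+z. ennreal (norm (with_boundary f z * cnj (with_boundary g z))) \<partial>omega) < \<infinity>" .
  then show ?thesis by (auto simp: integrable_iff_bounded)
qed

lemma omega_inner_self:
  assumes f: "f \<in> M2_omega"
  shows "ennreal (Re (omega_inner f f)) = L2sq omega (with_boundary f)" "0 \<le> Re (omega_inner f f)"
proof -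
  have eq: "with_boundary f z * cnj (with_boundary f z) = of_real ((cmod (with_boundary f z))\<^sup>2)" for z
    by (simp add: complex_norm_square del: of_real_power)
  have "integrable omega (\<lambda>z. complex_of_real ((cmod (with_boundary f z))\<^sup>2))"
    using integrable_with_boundary_mult[OF f f] unfolding eq .
  from integrable_Re[OF this] have int: "integrable omega (\<lambda>z. (cmod (with_boundary f z))\<^sup>2)" by simp
  have "omega_inner f f = of_real (\<integral>z. (cmod (with_boundary f z))\<^sup>2 \<partial>omega)"
    using f unfolding omega_inner_def eq by (simp del: of_real_power)
  then have Re: "Re (omega_inner f f) = (\<integral>z. (cmod (with_boundary f z))\<^sup>2 \<partial>omega)" by simp
  show "0 \<le> Re (omega_inner f f)" unfolding Re by simp
  show "ennreal (Re (omega_inner f f)) = L2sq omega (with_boundary f)"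
    unfolding Re L2sq_def using int by (intro nn_integral_eq_integral[symmetric]) auto
qed

lemma omega_inner_add_left:
  assumes f: "f \<in> M2_omega" and g: "g \<in> M2_omega" and h: "h \<in> M2_omega"
  shows "omega_inner (\<lambda>z. c * f z + g z) h = c * omega_inner f h + omega_inner g h"
proof -
  have [measurable]: "with_boundary f \<in> borel_measurable omega" "with_boundary g \<in> borel_measurable omega"
    "with_boundary h \<in> borel_measurable omega" "with_boundary (\<lambda>z. c * f z + g z) \<in> borel_measurable omega"
    using M2_omegaD(5) f g h M2_omega_lincomb[OF f g] by (auto intro: borel_imp_measurable_omega)
  have "omega_inner (\<lambda>z. c * f z + g z) h = (\<integral>z. with_boundary (\<lambda>z. c * f z + g z) z * cnj (with_boundary h z) \<partial>omega)"
    using M2_omega_lincomb[OF f g] h by (simp add: omega_inner_def)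
  also have "\<dots> = (\<integral>z. c * (with_boundary f z * cnj (with_boundary h z)) + with_boundary g z * cnj (with_boundary h z) \<partial>omega)"
  proof (rule integral_cong_AE)
    show "AE z in omega. with_boundary (\<lambda>z. c * f z + g z) z * cnj (with_boundary h z) =
       c * (with_boundary f z * cnj (with_boundary h z)) + with_boundary g z * cnj (with_boundary h z)"
      using with_boundary_lincomb_AE[OF f g, of c] by eventually_elim (simp add: algebra_simps)
  qed auto
  also have "\<dots> = c * omega_inner f h + omega_inner g h"
    using integrable_with_boundary_mult[OF f h] integrable_with_boundary_mult[OF g h] f g h
    by (simp add: omega_inner_def)
  finally show ?thesis .
qed

lemma omega_inner_commute: "omega_inner g f = cnj (omega_inner f g)"
proof -
  have "(\<lambda>z. with_boundary g z * cnj (with_boundary f z)) = (\<lambda>z. cnj (with_boundary f z * cnj (with_boundary g z)))"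
    by (simp add: mult.commute)
  then show ?thesis unfolding omega_inner_def by (simp del: complex_cnj_mult)
qed

text \<open>A line of index \<open>n\<close> carries the mass \<open>2^n / n!\<close> in \<open>\<omega>\<close>, and a single term is at most the sum.\<close>

lemma line_L2sq_le_omega:
  assumes [measurable]: "u \<in> borel_measurable borel"
  shows "L2sq lborel (\<lambda>y. u (Complex (real n / 2) y)) \<le> ennreal (fact n / 2 ^ n) * L2sq omega u"
proof -
  have "ennreal (2 ^ n / fact n) * L2sq lborel (\<lambda>y. u (Complex (real n / 2) y)) \<le> L2sq omega u"
    unfolding L2sq_omega[OF assms]
    using sum_le_suminf[of "\<lambda>n. ennreal (2^n/fact n) * L2sq lborel (\<lambda>y. u (Complex (real n/2) y))" "{n}"] by simp
  then have "ennreal (fact n / 2 ^ n) * (ennreal (2 ^ n / fact n) * L2sq lborel (\<lambda>y. u (Complex (real n / 2) y)))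
      \<le> ennreal (fact n / 2 ^ n) * L2sq omega u"
    by (rule mult_left_mono) simp
  also have "ennreal (fact n / 2 ^ n) * (ennreal (2 ^ n / fact n) * L2sq lborel (\<lambda>y. u (Complex (real n / 2) y)))
      = ennreal ((fact n / 2 ^ n) * (2 ^ n / fact n)) * L2sq lborel (\<lambda>y. u (Complex (real n / 2) y))"
    by (subst ennreal_mult) (auto simp: mult.assoc)
  also have "(fact n / 2 ^ n) * (2 ^ n / fact n) = (1::real)" by simp
  finally show ?thesis by simp
qed

text \<open>The summand \<open>2\<close> comes from the boundary values, which have weight \<open>1\<close> in \<open>\<omega>\<close>, and the
  quotient is the reciprocal weight of the line \<open>n/2\<close>.\<close>

definition strip_const :: "nat \<Rightarrow> real" where
  "strip_const n = 2 + fact n / 2 ^ n"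

lemma strip_const_pos: "strip_const n > 0"
  by (simp add: strip_const_def add_pos_pos)

lemma line_energy_le_omega:
  assumes f: "f \<in> M2_omega" and r: "L2sq omega (with_boundary f) \<le> ennreal r" "0 \<le> r"
    and x: "0 < x" "x < real n / 2"
  shows "line_energy f x \<le> ennreal (strip_const n * r)"
proof -
  note f' = M2_omegaD[OF f]
  have n: "n \<noteq> 0" using x by (intro notI) simp
  have "line_energy f x \<le> 2 * L2sq lborel (boundary_value f) + line_energy f (real n / 2)"
    using x f'(3) by (intro line_energy_le_boundary[of _ "real n / 2 + 1"] f'(6)) auto
  also have "L2sq lborel (boundary_value f) \<le> ennreal 1 * L2sq omega (with_boundary f)"
    using line_L2sq_le_omega[OF f'(5), of 0] by (simp add: with_boundary_def)
  also have "line_energy f (real n / 2) \<le> ennreal (fact n / 2 ^ n) * L2sq omega (with_boundary f)"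
    using line_L2sq_le_omega[OF f'(5), of n] n by (simp add: with_boundary_line line_energy_def)
  finally have "line_energy f x \<le> 2 * (ennreal 1 * L2sq omega (with_boundary f)) + ennreal (fact n / 2 ^ n) * L2sq omega (with_boundary f)"
    by (simp add: mult_left_mono add_mono)
  also have "\<dots> \<le> 2 * (ennreal 1 * ennreal r) + ennreal (fact n / 2 ^ n) * ennreal r"
    using r by (intro add_mono mult_left_mono) auto
  also have "\<dots> = ennreal (strip_const n * r)"
  proof -
    have "ennreal (strip_const n * r) = ennreal (2 * r) + ennreal (fact n / 2 ^ n * r)"
      unfolding strip_const_def distrib_right by (rule ennreal_plus) (use r in auto)
    also have "ennreal (2 * r) = 2 * (ennreal 1 * ennreal r)" using r by (simp add: ennreal_mult)
    also have "ennreal (fact n / 2 ^ n * r) = ennreal (fact n / 2 ^ n) * ennreal r"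
      by (rule ennreal_mult) (use r in auto)
    finally show ?thesis by (rule sym)
  qed
  finally show ?thesis .
qed

text \<open>Convergence in norm implies locally uniform convergence by this bound.\<close>

lemma point_bound_omega:
  assumes f: "f \<in> M2_omega" and r: "L2sq omega (with_boundary f) \<le> ennreal r" "0 < r"
    and d: "d > 0" "d < Re w" "Re w + d < real n / 2"
  shows "(cmod (f w))\<^sup>2 \<le> 2 * (strip_const n * r) * (1 + 1 / d\<^sup>2)"
proof (rule H2_strip_point_bound[where b = "real n / 2" and f = f and z = w])
  show "f holomorphic_on strip (real n / 2)"
    using d by (intro H2_stripD(1) M2_omegaD(3)[OF f]) auto
  show "0 < strip_const n * r" using strip_const_pos r by simp
  show "line_energy f t \<le> ennreal (strip_const n * r)" if "0 < t" "t < real n / 2" for t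
    using line_energy_le_omega[OF f r(1) _ that] r by simp
qed (use d in auto)

lemma evaluation_bounded:
  assumes w: "w \<in> right_half_plane"
  shows "\<exists>C>0. \<forall>f\<in>M2_omega. (cmod (f w))\<^sup>2 \<le> C * (ip_norm omega_inner f)\<^sup>2"
proof -
  define d where "d = Re w / 2"
  have d: "d > 0" "d < Re w" using w by (auto simp: d_def right_half_plane_def)
  obtain n where n: "2 * (Re w + d) < real n" using reals_Archimedean2 by blast
  define C where "C = 2 * strip_const n * (1 + 1 / d\<^sup>2)"
  have C: "C > 0" unfolding C_def using strip_const_pos[of n] by (intro mult_pos_pos add_pos_nonneg) auto
  have "(cmod (f w))\<^sup>2 \<le> C * (ip_norm omega_inner f)\<^sup>2" if f: "f \<in> M2_omega" for f
  \<comment> \<open>The margin \<open>e\<close> covers the function of norm \<open>0\<close>, as the point bound wants a positive bound.\<close>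
  proof (rule field_le_epsilon)
    fix e :: real assume e: "e > 0"
    let ?N = "(ip_norm omega_inner f)\<^sup>2"
    have N: "?N = Re (omega_inner f f)" unfolding ip_norm_def using omega_inner_self(2)[OF f] by simp
    have "L2sq omega (with_boundary f) \<le> ennreal (?N + e / C)"
      unfolding omega_inner_self(1)[OF f, symmetric] N using e C by (intro ennreal_leI) simp
    moreover have "0 < ?N + e / C" using e C by (intro add_nonneg_pos) auto
    ultimately have "(cmod (f w))\<^sup>2 \<le> 2 * (strip_const n * (?N + e / C)) * (1 + 1 / d\<^sup>2)"
      using n by (intro point_bound_omega[OF f] d) auto
    also have "\<dots> = C * (?N + e / C)" by (simp add: C_def)
    also have "\<dots> = C * ?N + e" using C by (simp add: distrib_left)
    finally show "(cmod (f w))\<^sup>2 \<le> C * ?N + e" .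
  qed
  with C show ?thesis by blast
qed

lemma omega_inner_product: "inner_product_on M2_omega omega_inner"
  unfolding inner_product_on_def
proof (intro conjI ballI allI impI)
  fix f g h assume f: "f \<in> M2_omega" and g: "g \<in> M2_omega" and h: "h \<in> M2_omega"
  show "omega_inner (f + g) h = omega_inner f h + omega_inner g h"
    using omega_inner_add_left[OF f g h, of 1] by (simp add: plus_fun_def)
next
  fix c f g assume f: "f \<in> M2_omega" and g: "g \<in> M2_omega"
  have "omega_inner 0 g = 0"
    using omega_inner_add_left[OF M2_omega_zero M2_omega_zero g, of 1] by (simp add: zero_fun_def)
  then show "omega_inner (\<lambda>x. c * f x) g = c * omega_inner f g"
    using omega_inner_add_left[OF f M2_omega_zero g, of c] by simp
next
  fix f g :: "complex \<Rightarrow> complex"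
  show "omega_inner g f = cnj (omega_inner f g)" by (rule omega_inner_commute)
next
  fix f assume f: "f \<in> M2_omega" and "f \<noteq> 0"
  show "0 < Re (omega_inner f f)"
  proof (rule ccontr)
    assume "\<not> 0 < Re (omega_inner f f)"
    then have "ip_norm omega_inner f = 0" using omega_inner_self(2)[OF f] by (simp add: ip_norm_def)
    then have "f w = 0" if "w \<in> right_half_plane" for w using evaluation_bounded[OF that] f by force
    then have "f = 0" using M2_omegaD(2)[OF f] by (auto simp: fun_eq_iff)
    with \<open>f \<noteq> 0\<close> show False ..
  qed
qed

interpretation M2: function_inner_product M2_omega omega_inner
  by standard (rule M2_omega_subspace, rule omega_inner_product)

lemma ip_norm_omega_inner:
  assumes "f \<in> M2_omega"
  shows "ennreal ((ip_norm omega_inner f)\<^sup>2) = L2sq omega (with_boundary f)"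
  using omega_inner_self[OF assms] by (simp add: ip_norm_def)

text \<open>The pointwise limit \<open>f\<close> exists locally uniformly and inherits, by Fatou, the estimates on all
  lines. The difference from the sequence tends to \<open>0\<close> on each line, on the imaginary axis because the
  difference has the difference of boundary values as its boundary value. What remains is to
  pass from the single lines to the whole series.\<close>

lemma M2_square_cauchy_converges:
  assumes cauchy: "M2.square_cauchy \<sigma>"
  shows "\<exists>f\<in>M2_omega. (\<lambda>n. ip_norm omega_inner (\<sigma> n - f)) \<longlonglongrightarrow> 0"
proof -
  have mem: "\<sigma> n \<in> M2_omega" for n using cauchy by (simp add: M2.square_cauchy_def)
  note \<sigma> = M2_omegaD[OF mem]
  have diff_mem: "\<sigma> m - \<sigma> n \<in> M2_omega" for m n by (intro M2_omega_diff mem)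
  have small: "\<exists>N. \<forall>m\<ge>N. \<forall>n\<ge>N. L2sq omega (with_boundary (\<sigma> m - \<sigma> n)) \<le> ennreal e" if e: "e > 0" for e
  proof -
    obtain N where N: "\<And>m n. m \<ge> N \<Longrightarrow> n \<ge> N \<Longrightarrow> (ip_norm omega_inner (\<sigma> m - \<sigma> n))\<^sup>2 \<le> e"
      using cauchy e unfolding M2.square_cauchy_def by meson
    have "L2sq omega (with_boundary (\<sigma> m - \<sigma> n)) \<le> ennreal e" if "m \<ge> N" "n \<ge> N" for m n
      unfolding ip_norm_omega_inner[OF diff_mem, symmetric] by (rule ennreal_leI[OF N[OF that]])
    then show ?thesis by blast
  qed
  have point: "(cmod (\<sigma> m w - \<sigma> n w))\<^sup>2 \<le> 2 * (strip_const k * e) * (1 + 1 / d\<^sup>2)"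
    if "L2sq omega (with_boundary (\<sigma> m - \<sigma> n)) \<le> ennreal e" "0 < e" "d > 0" "d < Re w" "Re w + d < real k / 2"
    for m n w e d k
    using point_bound_omega[OF diff_mem that] by simp
  have lines: "L2sq lborel (\<lambda>y. \<sigma> m (Complex x y) - \<sigma> n (Complex x y)) \<le> ennreal (strip_const k * e)"
    if "L2sq omega (with_boundary (\<sigma> m - \<sigma> n)) \<le> ennreal e" "0 < e" "0 < x" "x < real k / 2" for m n x e k
    using line_energy_le_omega[OF diff_mem that(1) less_imp_le[OF that(2)] that(3,4)] by (simp add: line_energy_def)
  have ball: "d < Re w \<and> Re w + d < real k / 2"
    if z: "d = Re z / 3" "2 * (Re z + 2 * d) < real k" "0 < d" and w: "w \<in> cball z d" for z w d k
  proof -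
    have "\<bar>Re z - Re w\<bar> \<le> d" using w abs_Re_le_cmod[of "z - w"] by (simp add: dist_norm)
    then have "Re z - Re w \<le> d" "Re w - Re z \<le> d" by linarith+
    moreover have "Re z + 2 * d < real k / 2" using z(2) by simp
    moreover have "Re z = 3 * d" using z(1) by simp
    ultimately show ?thesis using z(3) by (intro conjI) linarith+
  qed
  \<comment> \<open>Discs of radius \<open>Re z / 3\<close> stay at distance more than that radius from the imaginary axis.\<close>
  have uc: "uniformly_convergent_on (cball z (Re z / 3)) \<sigma>" if z: "z \<in> right_half_plane" for z
  proof (rule Cauchy_uniformly_convergent, rule uniformly_Cauchy_onI)
    define d where "d = Re z / 3"
    have d: "d > 0" using z by (simp add: d_def right_half_plane_def)
    obtain k where k: "2 * (Re z + 2 * d) < real k" using reals_Archimedean2 by blast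
    define C where "C = 2 * strip_const k * (1 + 1 / d\<^sup>2)"
    have C: "C > 0" unfolding C_def using strip_const_pos[of k] by (intro mult_pos_pos add_pos_nonneg) auto
    fix e :: real assume e: "e > 0"
    define e' where "e' = (e / 2)\<^sup>2 / C"
    have e': "e' > 0" using e C by (simp add: e'_def)
    obtain N where N: "\<forall>m\<ge>N. \<forall>n\<ge>N. L2sq omega (with_boundary (\<sigma> m - \<sigma> n)) \<le> ennreal e'"
      using small[OF e'] by blast
    have "dist (\<sigma> m w) (\<sigma> n w) < e" if w: "w \<in> cball z (Re z / 3)" and mn: "m \<ge> N" "n \<ge> N" for w m n
    proof -
      have "(cmod (\<sigma> m w - \<sigma> n w))\<^sup>2 \<le> 2 * (strip_const k * e') * (1 + 1 / d\<^sup>2)"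
        using N mn e' d ball[OF d_def k d] w by (intro point) (auto simp: d_def)
      also have "\<dots> = C * e'" by (simp add: C_def)
      also have "\<dots> = (e / 2)\<^sup>2" using C by (simp add: e'_def)
      finally have "cmod (\<sigma> m w - \<sigma> n w) \<le> e / 2" by (rule power2_le_imp_le) (use e in auto)
      then show ?thesis using e by (simp add: dist_norm)
    qed
    then show "\<exists>M. \<forall>x\<in>cball z (Re z / 3). \<forall>m\<ge>M. \<forall>n\<ge>M. dist (\<sigma> m x) (\<sigma> n x) < e" by blast
  qed
  define f where "f z = (if z \<in> right_half_plane then lim (\<lambda>n. \<sigma> n z) else 0)" for z
  have ball_sub: "cball z (Re z / 3) \<subseteq> right_half_plane" if z: "z \<in> right_half_plane" for z
  proof
    fix w assume "w \<in> cball z (Re z / 3)"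
    then have "\<bar>Re z - Re w\<bar> \<le> Re z / 3" using abs_Re_le_cmod[of "z - w"] by (simp add: dist_norm)
    moreover have "0 < Re z" using z by (simp add: right_half_plane_def)
    ultimately have "0 < Re w" by linarith
    then show "w \<in> right_half_plane" by (simp add: right_half_plane_def)
  qed
  have unif: "uniform_limit (cball z (Re z / 3)) \<sigma> f sequentially" if z: "z \<in> right_half_plane" for z
  proof -
    have "uniform_limit (cball z (Re z / 3)) \<sigma> (\<lambda>w. lim (\<lambda>n. \<sigma> n w)) sequentially"
      using uc[OF z] by (simp add: uniformly_convergent_uniform_limit_iff)
    then show ?thesis
      by (rule uniform_limit_cong'[THEN iffD1, rotated 2]) (use ball_sub[OF z] in \<open>auto simp: f_def\<close>)
  qed
  have lim: "(\<lambda>n. \<sigma> n z) \<longlonglongrightarrow> f z" if z: "z \<in> right_half_plane" for z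
    using z by (intro tendsto_uniform_limitI[OF unif[OF z]]) (auto simp: right_half_plane_def)
  have f_zero: "f z = 0" if "z \<notin> right_half_plane" for z using that by (simp add: f_def)
  have f_hol: "f holomorphic_on right_half_plane"
  proof (rule holomorphic_uniform_sequence)
    show "open right_half_plane" unfolding right_half_plane_def by (rule open_halfspace_Re_gt)
    show "\<sigma> n holomorphic_on right_half_plane" for n by (rule \<sigma>(1))
    show "\<exists>d>0. cball z d \<subseteq> right_half_plane \<and> uniform_limit (cball z d) \<sigma> f sequentially"
      if z: "z \<in> right_half_plane" for z
      using unif[OF z] ball_sub[OF z] z by (intro exI[of _ "Re z / 3"]) (auto simp: right_half_plane_def)
  qed
  have meas: "(\<lambda>y. \<sigma> n (Complex x y)) \<in> borel_measurable borel" if "0 < x" for n x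
    using line_borel_measurable[OF H2_stripD(1)[OF \<sigma>(3)[of "x + 1" n]], of x] that by simp
  have f_strip: "f holomorphic_on strip b" for b
    using f_hol by (rule holomorphic_on_subset) (auto simp: strip_def right_half_plane_def)
  have meas_f: "(\<lambda>y. f (Complex x y)) \<in> borel_measurable borel" if "0 < x" for x
    using line_borel_measurable[OF f_strip[of "x + 1"], of x] that by simp
  have f_lines: "L2sq lborel (\<lambda>y. f (Complex x y) - \<sigma> n (Complex x y)) \<le> ennreal (strip_const k * e)"
    if N: "\<forall>m\<ge>N. \<forall>n\<ge>N. L2sq omega (with_boundary (\<sigma> m - \<sigma> n)) \<le> ennreal e"
      and n: "n \<ge> N" and e: "0 < e" and x: "0 < x" "x < real k / 2" for N n e x k
  proof (rule L2sq_Fatou)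
    show "AE y in lborel. (\<lambda>m. \<sigma> m (Complex x y)) \<longlonglongrightarrow> f (Complex x y)"
      using x by (intro AE_I2 lim) (simp add: right_half_plane_def)
    show "\<forall>\<^sub>F m in sequentially. L2sq lborel (\<lambda>y. \<sigma> m (Complex x y) - \<sigma> n (Complex x y)) \<le> ennreal (strip_const k * e)"
      using eventually_ge_at_top[of N] by eventually_elim (use N n e x lines in auto)
  qed (use meas x in auto)
  have f_H2: "f \<in> H2_strip b" if b: "b > 0" for b
  proof -
    obtain N where N: "\<forall>m\<ge>N. \<forall>n\<ge>N. L2sq omega (with_boundary (\<sigma> m - \<sigma> n)) \<le> ennreal 1"
      using small[of 1] by auto
    obtain k where k: "2 * b < real k" using reals_Archimedean2 by blast
    obtain M where M: "M > 0" "\<And>t. 0 < t \<Longrightarrow> t < b \<Longrightarrow> line_energy (\<sigma> N) t \<le> ennreal M"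
      using H2_stripD(2)[OF \<sigma>(3)[OF b]] by blast
    show ?thesis
    proof (rule H2_stripI[OF f_strip])
      fix t assume t: "0 < t" "t < b"
      have "line_energy f t \<le> 2 * L2sq lborel (\<lambda>y. f (Complex t y) - \<sigma> N (Complex t y)) + 2 * line_energy (\<sigma> N) t"
        unfolding line_energy_def using meas[OF t(1)] meas_f[OF t(1)] by (intro L2sq_le_diff) auto
      also have "\<dots> \<le> 2 * ennreal (strip_const k * 1) + 2 * ennreal M"
        using f_lines[OF N, of N t k] t k M(2)[OF t] by (intro add_mono mult_left_mono) auto
      also have "\<dots> = ennreal (2 * strip_const k + 2 * M)"
        using strip_const_pos[of k] M by (simp add: ennreal_plus ennreal_mult)
      finally show "line_energy f t \<le> ennreal (2 * strip_const k + 2 * M)" .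
    qed
  qed
  have f_bv: "is_boundary_value f (boundary_value f)"
    using is_boundary_value_boundary_value[OF f_H2[of 1]] by simp
  have wb_f[measurable]: "with_boundary f \<in> borel_measurable borel"
    using with_boundary_measurable[OF f_hol f_zero f_H2[of 1]] by simp
  have wb_\<sigma>[measurable]: "with_boundary (\<sigma> n) \<in> borel_measurable borel" for n by (rule \<sigma>(5))
  define a where "a j n = L2sq lborel (\<lambda>y. with_boundary f (Complex (real j / 2) y) - with_boundary (\<sigma> n) (Complex (real j / 2) y))" for j n
  have a_le: "a j n \<le> 2 * ennreal (strip_const (Suc j) * e)"
    if N: "\<forall>m\<ge>N. \<forall>n\<ge>N. L2sq omega (with_boundary (\<sigma> m - \<sigma> n)) \<le> ennreal e"
      and n: "n \<ge> N" and e: "0 < e" for N n e j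
  proof (cases "j = 0")
    case True
    have "is_boundary_value (\<lambda>z. -1 * \<sigma> n z + f z) (\<lambda>y. -1 * boundary_value (\<sigma> n) y + boundary_value f y)"
      by (rule is_boundary_value_lincomb[where b = "1/2", OF \<sigma>(3) f_H2 _ \<sigma>(6) f_bv]) auto
    then have bv: "is_boundary_value (\<lambda>z. f z - \<sigma> n z) (\<lambda>y. boundary_value f y - boundary_value (\<sigma> n) y)" by simp
    have "(\<lambda>z. f z - \<sigma> n z) holomorphic_on strip (1/2)"
      using f_strip H2_stripD(1)[OF \<sigma>(3)[of "1/2"]] by (intro holomorphic_intros) auto
    then have "L2sq lborel (\<lambda>y. boundary_value f y - boundary_value (\<sigma> n) y) \<le> 2 * ennreal (strip_const 1 * e)"
      using f_lines[OF N n e, of _ 1] by (intro boundary_L2sq_le[OF _ _ bv]) (auto simp: line_energy_def)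
    then show ?thesis using True by (simp add: a_def with_boundary_def)
  next
    case False
    have "a j n \<le> ennreal (strip_const (Suc j) * e)"
      using f_lines[OF N n e, of "real j / 2" "Suc j"] False by (simp add: a_def with_boundary_line)
    also have "\<dots> \<le> 2 * ennreal (strip_const (Suc j) * e)"
      using mult_right_mono[of 1 2 "ennreal (strip_const (Suc j) * e)"] by simp
    finally show ?thesis .
  qed
  have a_lim: "(\<lambda>n. a j n) \<longlonglongrightarrow> 0" for j
  proof (rule order_tendstoI)
    fix u :: ennreal assume "0 < u"
    then obtain v where v: "0 < v" "v < u" using dense by blast
    then obtain r where r: "0 < r" "ennreal r < u"
      by (cases v) (auto simp: top.not_eq_extremum[symmetric] top_unique)
    define e where "e = r / (2 * strip_const (Suc j))"
    have e: "e > 0" using r strip_const_pos by (simp add: e_def)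
    obtain N where N: "\<forall>m\<ge>N. \<forall>n\<ge>N. L2sq omega (with_boundary (\<sigma> m - \<sigma> n)) \<le> ennreal e"
      using small[OF e] by blast
    show "\<forall>\<^sub>F n in sequentially. a j n < u"
      using eventually_ge_at_top[of N]
    proof eventually_elim
      case (elim n)
      have "a j n \<le> 2 * ennreal (strip_const (Suc j) * e)" by (rule a_le[OF N elim e])
      also have "\<dots> = ennreal (2 * (strip_const (Suc j) * e))"
        using e strip_const_pos[of "Suc j"] by (subst ennreal_mult) auto
      also have "2 * (strip_const (Suc j) * e) = r" using strip_const_pos[of "Suc j"] by (simp add: e_def)
      finally show ?case using r(2) by simp
    qed
  qed auto
  \<comment> \<open>The line estimates have constants that grow too fast to be summed against the weights. In a partial
     sum, \<open>f\<close> is replaced by a far term of the sequence, and the series for two terms is small.\<close>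
  have total: "L2sq omega (\<lambda>z. with_boundary f z - with_boundary (\<sigma> n) z) \<le> 2 * ennreal e"
    if N: "\<forall>m\<ge>N. \<forall>n\<ge>N. L2sq omega (with_boundary (\<sigma> m - \<sigma> n)) \<le> ennreal e"
      and n: "n \<ge> N" for N n e
  proof -
    let ?w = "\<lambda>j. ennreal (2 ^ j / fact j)"
    have partial: "(\<Sum>j<K. ?w j * a j n) \<le> 2 * ennreal e" for K
    proof -
      have step: "(\<Sum>j<K. ?w j * a j n) \<le> 2 * (\<Sum>j<K. ?w j * a j m) + 2 * ennreal e" if m: "m \<ge> N" for m
      proof -
        let ?d = "\<lambda>j. L2sq lborel (\<lambda>y. with_boundary (\<sigma> m) (Complex (real j / 2) y) - with_boundary (\<sigma> n) (Complex (real j / 2) y))"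
        have "a j n \<le> 2 * a j m + 2 * ?d j" for j
          unfolding a_def using measurable_vertical_line[measurable] by (intro L2sq_diff_le) auto
        then have "(\<Sum>j<K. ?w j * a j n) \<le> (\<Sum>j<K. ?w j * (2 * a j m + 2 * ?d j))"
          by (intro sum_mono mult_left_mono) auto
        also have "\<dots> = 2 * (\<Sum>j<K. ?w j * a j m) + 2 * (\<Sum>j<K. ?w j * ?d j)"
          by (simp add: distrib_left sum.distrib sum_distrib_left mult.left_commute)
        also have "(\<Sum>j<K. ?w j * ?d j) \<le> (\<Sum>j. ?w j * ?d j)" by (rule sum_le_suminf) auto
        also have "(\<Sum>j. ?w j * ?d j) = L2sq omega (\<lambda>z. with_boundary (\<sigma> m) z - with_boundary (\<sigma> n) z)"
          by (rule L2sq_omega[symmetric]) measurable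
        also have "\<dots> = L2sq omega (with_boundary (\<sigma> m - \<sigma> n))"
          by (rule L2sq_cong_AE[symmetric, OF with_boundary_diff_AE[OF mem mem]])
        also have "\<dots> \<le> ennreal e" using N m n by blast
        finally show ?thesis by (simp add: add_left_mono mult_left_mono)
      qed
      have "(\<lambda>m. 2 * (\<Sum>j<K. ?w j * a j m) + 2 * ennreal e) \<longlonglongrightarrow> 2 * (\<Sum>j<K. ?w j * 0) + 2 * ennreal e"
        by (intro tendsto_add tendsto_sum ennreal_tendsto_cmult a_lim tendsto_const) auto
      moreover have "\<forall>\<^sub>F m in sequentially. (\<Sum>j<K. ?w j * a j n) \<le> 2 * (\<Sum>j<K. ?w j * a j m) + 2 * ennreal e"
        using eventually_ge_at_top[of N] by eventually_elim (rule step)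
      ultimately have "(\<Sum>j<K. ?w j * a j n) \<le> 2 * (\<Sum>j<K. ?w j * 0) + 2 * ennreal e"
        by (rule tendsto_lowerbound) simp
      then show ?thesis by simp
    qed
    have "L2sq omega (\<lambda>z. with_boundary f z - with_boundary (\<sigma> n) z) = (\<Sum>j. ?w j * a j n)"
      unfolding a_def by (rule L2sq_omega) measurable
    also have "\<dots> \<le> 2 * ennreal e"
      using partial by (intro suminf_le_const summableI) auto
    finally show ?thesis .
  qed
  have f_mem: "f \<in> M2_omega"
  proof (rule M2_omegaI[OF f_hol f_zero f_H2])
    obtain N where N: "\<forall>m\<ge>N. \<forall>n\<ge>N. L2sq omega (with_boundary (\<sigma> m - \<sigma> n)) \<le> ennreal 1"
      using small[of 1] by auto
    have "L2sq omega (with_boundary f) \<le> 2 * L2sq omega (\<lambda>z. with_boundary f z - with_boundary (\<sigma> N) z) + 2 * L2sq omega (with_boundary (\<sigma> N))"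
      by (intro L2sq_le_diff borel_imp_measurable_omega) measurable
    also have "\<dots> \<le> 2 * (2 * ennreal 1) + 2 * L2sq omega (with_boundary (\<sigma> N))"
      using total[OF N, of N] by (intro add_mono mult_left_mono) auto
    also have "\<dots> < \<infinity>" using \<sigma>(4)[of N] by (simp add: ennreal_mult_less_top)
    finally show "L2sq omega (with_boundary f) < \<infinity>" .
  qed
  have "(\<lambda>n. ip_norm omega_inner (\<sigma> n - f)) \<longlonglongrightarrow> 0"
  proof (rule LIMSEQ_I)
    fix r :: real assume r: "r > 0"
    define e where "e = r\<^sup>2 / 4"
    have e: "e > 0" using r by (simp add: e_def)
    obtain N where N: "\<forall>m\<ge>N. \<forall>n\<ge>N. L2sq omega (with_boundary (\<sigma> m - \<sigma> n)) \<le> ennreal e"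
      using small[OF e] by blast
    have "norm (ip_norm omega_inner (\<sigma> n - f) - 0) < r" if n: "n \<ge> N" for n
    proof -
      let ?x = "ip_norm omega_inner (\<sigma> n - f)"
      have "ennreal (?x\<^sup>2) = L2sq omega (with_boundary (\<sigma> n - f))"
        by (rule ip_norm_omega_inner[OF M2_omega_diff[OF mem f_mem]])
      also have "\<dots> = L2sq omega (\<lambda>z. with_boundary f z - with_boundary (\<sigma> n) z)"
        by (subst L2sq_minus_commute) (rule L2sq_cong_AE[OF with_boundary_diff_AE[OF mem f_mem]])
      also have "\<dots> \<le> 2 * ennreal e" by (rule total[OF N n])
      also have "\<dots> = ennreal (2 * e)" using e by (subst ennreal_mult) auto
      finally have "?x\<^sup>2 \<le> 2 * e" using e by (subst (asm) ennreal_le_iff) auto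
      also have "\<dots> < r\<^sup>2" using r by (simp add: e_def)
      finally have "?x < r" by (rule power2_less_imp_less) (use r in auto)
      then show ?thesis using M2.ip_norm_nonneg[OF M2_omega_diff[OF mem f_mem], of n] by simp
    qed
    then show "\<exists>no. \<forall>n\<ge>no. norm (ip_norm omega_inner (\<sigma> n - f) - 0) < r" by blast
  qed
  with f_mem show ?thesis by blast
qed

lemma omega_norm_series:
  assumes f: "f \<in> M2_omega"
  shows "ennreal ((ip_norm omega_inner f)\<^sup>2) = (\<Sum>n. ennreal (2 ^ n / fact n) *
      (\<integral>\<^sup>+y. ennreal ((cmod (with_boundary f (Complex (real n / 2) y)))\<^sup>2) \<partial>lborel))"
  unfolding ip_norm_omega_inner[OF f] L2sq_omega[OF M2_omegaD(5)[OF f]] by (simp add: L2sq_def)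

theorem theorem1:
  defines "N \<equiv> \<lambda>f::complex \<Rightarrow> complex. \<Sum>n. ennreal (2 ^ n / fact n) *
      (\<integral>\<^sup>+y. ennreal ((cmod (with_boundary f (Complex (real n / 2) y)))\<^sup>2) \<partial>lborel)"
  shows "\<exists>ip.
      hilbert_space_on M2_omega ip \<and>
      (\<exists>K. reproducing_kernel_on right_half_plane M2_omega ip K) \<and>
      (\<forall>f\<in>M2_omega. ennreal ((ip_norm ip f)\<^sup>2) = N f \<and> N f < \<infinity>) \<and>
      (\<forall>ip'. inner_product_on M2_omega ip' \<and>
             (\<forall>f\<in>M2_omega. ennreal ((ip_norm ip' f)\<^sup>2) = N f) \<longrightarrow>
             (\<forall>f\<in>M2_omega. \<forall>g\<in>M2_omega. ip' f g = ip f g))"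
proof (intro exI[of _ omega_inner] conjI allI impI ballI)
  have N: "ennreal ((ip_norm omega_inner f)\<^sup>2) = N f" if "f \<in> M2_omega" for f
    unfolding N_def using omega_norm_series[OF that] .
  have complete: "\<exists>k\<in>M2_omega. (\<lambda>n. ip_norm omega_inner (\<sigma> n - k)) \<longlonglongrightarrow> 0" if "M2.square_cauchy \<sigma>" for \<sigma>
    using M2_square_cauchy_converges[OF that] .
  show "hilbert_space_on M2_omega omega_inner"
    unfolding hilbert_space_on_def
    by (intro conjI M2_omega_subspace omega_inner_product M2.mcomplete_ip_norm complete) (simp add: omega_inner_def)
  have "\<exists>k\<in>M2_omega. \<forall>f\<in>M2_omega. f w = omega_inner f k" if w: "w \<in> right_half_plane" for w
  proof -
    obtain C where C: "C > 0" "\<And>f. f \<in> M2_omega \<Longrightarrow> (cmod (f w))\<^sup>2 \<le> C * (ip_norm omega_inner f)\<^sup>2"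
      using evaluation_bounded[OF w] by blast
    show ?thesis by (rule M2.Riesz_representation[where L = "\<lambda>f. f w" and C = C]) (use complete C in auto)
  qed
  then obtain K where "\<And>w. w \<in> right_half_plane \<Longrightarrow> K w \<in> M2_omega \<and> (\<forall>f\<in>M2_omega. f w = omega_inner f (K w))"
    by metis
  then show "\<exists>K. reproducing_kernel_on right_half_plane M2_omega omega_inner K"
    unfolding reproducing_kernel_on_def by blast
  show "ennreal ((ip_norm omega_inner f)\<^sup>2) = N f" if "f \<in> M2_omega" for f by (rule N[OF that])
  show "N f < \<infinity>" if "f \<in> M2_omega" for f unfolding N[OF that, symmetric] by simp
  fix ip' f g
  assume ip': "inner_product_on M2_omega ip' \<and> (\<forall>f\<in>M2_omega. ennreal ((ip_norm ip' f)\<^sup>2) = N f)"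
    and fg: "f \<in> M2_omega" "g \<in> M2_omega"
  have "(ip_norm ip' h)\<^sup>2 = (ip_norm omega_inner h)\<^sup>2" if "h \<in> M2_omega" for h
  proof -
    have "ennreal ((ip_norm ip' h)\<^sup>2) = ennreal ((ip_norm omega_inner h)\<^sup>2)" using ip' N that by simp
    then show ?thesis by (subst (asm) ennreal_inj) auto
  qed
  then show "ip' f g = omega_inner f g"
    using ip' fg by (intro M2.polarization_unique) auto
qed

end
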